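(* Let $K$ be a field, $\dot E=(E,C,D)$ a bi-separated graph, and $(F,\phi)$ an object of $\mathbf{RG}(\dot E)$, i.e. a representation graph for $\dot E$. Let $V(F,\phi)$ be the right $L(\dot E)$-module defined by $(F,\phi)$. Then the following are equivalent. (i) $V(F,\phi)$ is simple. (ii) For any $x\in V(F,\phi)\setminus\{0\}$ there is an $a\in L(\dot E)$ such that $x.a\in F^0$. (iii) For any $x\in V(F,\phi)\setminus\{0\}$ there are a $k\in K$ and a $p\in\operatorname{Walk}(E)$ such that $x.kp\in F^0$. (iv) $(F,\phi)$ is irreducible.
   Context: Graphs. A (directed) graph is a quadruple $E=(E^0,E^1,s,r)$ with sets $E^0$ (vertices), $E^1$ (edges) and maps $s,r:E^1\to E^0$ (source, range). A graph homomorphism $\phi:F\to E$ is a pair of maps $\phi^0:F^0\to E^0$, $\phi^1:F^1\to E^1$ with $s(\phi^1(e))=\phi^0(s(e))$, $r(\phi^1(e))=\phi^0(r(e))$; both are written $\phi$. The double graph $\hat E$ has vertex set $E^0$ and edges $e,e^*$ ($e\in E^1$), with $e$ as in $E$ and $e^*$ having source $r(e)$ and range $s(e)$. A walk in $E$ is a path in $\hat E$: either a single vertex (trivial walk) or a finite nonempty sequence $x_1\dots x_n$ of edges of $\hat E$ with $r(x_i)=s(x_{i+1})$. $\operatorname{Walk}(E)$ is the set of walks and ${}_u\!\operatorname{Walk}(E)$ the set of walks starting in $u$. A graph homomorphism induces a map on walks (with $\phi(e^* )=\phi(e)^*$). All graphs are assumed to have at least one vertex and to be connected, i.e. for all vertices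 $u,v$ there is a walk from $u$ to $v$. Bi-separated graphs. A bi-separated graph is a triple $\dot E=(E,C,D)$ with $E$ a graph, $C=\bigsqcup_{v\in E^0}C_v$ with $C_v$ a partition of $s^{-1}(v)$, $D=\bigsqcup_{v\in E^0}D_v$ with $D_v$ a partition of $r^{-1}(v)$, and $|X\cap Y|\le 1$ for all $X\in C$, $Y\in D$. All bi-separated graphs are assumed finitely bi-separated: every $X\in C$ and every $Y\in D$ is a finite set. For $X\in C$, $s(X)$ is the common source of the edges in $X$; for $Y\in D$, $r(Y)$ is the common range of the edges in $Y$; $XY=YX:=e$ if $X\cap Y=\{e\}$ and $XY=YX:=0$ if $X\cap Y=\emptyset$ (with $0^*=0$). Leavitt path algebra. For a field $K$, algebras are associative, not necessarily unital. The path algebra $P(\hat E)$ of $\hat E$ is the $K$-algebra generated by the vertices and edges of $\hat E$ with relations $uv=\delta_{uv}u$ for vertices and $s(x)x=x=xr(x)$ for edges (source and range in $\hat E$). $L(\dot E)$ is the quotient of $P(\hat E)$ by the relations (L1) $\sum_{Y\in D}(XY)(YX')^*=\delta_{XX'}s(X)$ for $X,X'\in C$ and (L2) $\sum_{X\in C}(YX)^*(XY')=\delta_{YY'}r(Y)$ for $Y,Y'\in D$. Walks in $E$ are regarded as elements of $L(\dot E)$; they span $L(\dot E)$. Representation graphs. A representation graph for $\dot E$ is a pair $(F,\phi)$ with $F$ a graph and $\phi:F\to E$ a graph homomorphism such that (i) for any $w\in F^0$ and $X\in C_{\phi(w)}$ there is precisely one $f\in s^{-1}(w)$ with $\phi(f)\in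 X$; (ii) for any $w\in F^0$ and $Y\in D_{\phi(w)}$ there is precisely one $f\in r^{-1}(w)$ with $\phi(f)\in Y$. $\mathbf{RG}(\dot E)$ is the category of representation graphs for $\dot E$; a morphism $(F,\phi)\to(G,\psi)$ is a graph homomorphism $\alpha:F\to G$ with $\psi\circ\alpha=\phi$. $(F,\phi)$ is irreducible if $\phi({}_u\!\operatorname{Walk}(F))\ne\phi({}_v\!\operatorname{Walk}(F))$ for any $u\neq v\in F^0$. The module $V(F,\phi)$. $V(F,\phi)$ is the $K$-vector space with basis $F^0$. For $v\in E^0$, $e\in E^1$ and $w\in F^0$ put $\sigma_v(w)=w$ if $\phi(w)=v$ and $0$ otherwise; $\sigma_e(w)=r(f)$ if there is $f\in F^1$ with $s(f)=w$, $\phi(f)=e$, and $0$ otherwise; $\sigma_{e^*}(w)=s(f)$ if there is $f\in F^1$ with $r(f)=w$, $\phi(f)=e$, and $0$ otherwise (such $f$ is unique). There is a unique $K$-algebra homomorphism $\pi:L(\dot E)\to\operatorname{End}_K(V(F,\phi))^{\rm op}$ with $\pi(v)=\sigma_v$, $\pi(e)=\sigma_e$, $\pi(e^* )=\sigma_{e^*}$, and $V(F,\phi)$ is a right $L(\dot E)$-module via $x.a:=\pi(a)(x)$. *)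

theory Defs
  imports "Graph_Theory.Arc_Walk" "HOL-Library.Poly_Mapping" "HOL-Library.FuncSet"
    "HOL-Library.Disjoint_Sets"
begin

section \<open>Graphs and walks\<close>

text \<open>
  A graph is a \<open>pre_digraph\<close> satisfying \<open>wf_digraph\<close>; \<open>tail\<close> is the source map and
  \<open>head\<close> the range map. \<open>Real e\<close> is the edge $e$ of the double graph, \<open>Ghost e\<close> is $e^*$.
\<close>

datatype 'e dedge = Real 'e | Ghost 'e

definition double_graph :: "('v, 'e) pre_digraph \<Rightarrow> ('v, 'e dedge) pre_digraph" where
  "double_graph G =
    \<lparr> verts = verts G,
      arcs = Real ` arcs G \<union> Ghost ` arcs G,
      tail = case_dedge (tail G) (head G),
      head = case_dedge (head G) (tail G) \<rparr>"

text \<open>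
  A walk is stored as its starting vertex together with its list of edges in the double
  graph; the empty list gives the trivial walk at that vertex.
\<close>

definition Walk :: "('v, 'e) pre_digraph \<Rightarrow> ('v \<times> 'e dedge list) set" where
  "Walk G = {(u, p). \<exists>v. pre_digraph.awalk (double_graph G) u p v}"

definition Walk_from :: "('v, 'e) pre_digraph \<Rightarrow> 'v \<Rightarrow> ('v \<times> 'e dedge list) set" where
  "Walk_from G u = {w \<in> Walk G. fst w = u}"

definition walk_map ::
  "('w \<Rightarrow> 'v) \<Rightarrow> ('f \<Rightarrow> 'e) \<Rightarrow> 'w \<times> 'f dedge list \<Rightarrow> 'v \<times> 'e dedge list" where
  "walk_map \<phi>0 \<phi>1 = (\<lambda>(u, p). (\<phi>0 u, map (map_dedge \<phi>1) p))"

definition graph_hom ::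
  "('w, 'f) pre_digraph \<Rightarrow> ('v, 'e) pre_digraph \<Rightarrow> ('w \<Rightarrow> 'v) \<Rightarrow> ('f \<Rightarrow> 'e) \<Rightarrow> bool" where
  "graph_hom F E \<phi>0 \<phi>1 \<longleftrightarrow>
     (\<forall>w\<in>verts F. \<phi>0 w \<in> verts E) \<and>
     (\<forall>f\<in>arcs F. \<phi>1 f \<in> arcs E \<and>
        tail E (\<phi>1 f) = \<phi>0 (tail F f) \<and> head E (\<phi>1 f) = \<phi>0 (head F f))"

locale conn_graph = wf_digraph G for G :: "('v, 'e) pre_digraph" +
  assumes verts_nonempty: "verts G \<noteq> {}"
    and walk_connected:
      "u \<in> verts G \<Longrightarrow> v \<in> verts G \<Longrightarrow> \<exists>p. pre_digraph.awalk (double_graph G) u p v"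


section \<open>Bi-separated graphs and representation graphs\<close>

text \<open>
  The partitions are given as families \<open>C v\<close>, \<open>D v\<close> indexed by the vertices. Since the
  blocks of a partition are nonempty and the sets of edges starting (ending) in distinct
  vertices are disjoint, the unions \<open>blocks E C\<close> and \<open>blocks E D\<close> are disjoint unions.
\<close>

definition blocks :: "('v, 'e) pre_digraph \<Rightarrow> ('v \<Rightarrow> 'e set set) \<Rightarrow> 'e set set" where
  "blocks E C = (\<Union>v\<in>verts E. C v)"

locale bisep_graph = conn_graph E
  for E :: "('v, 'e) pre_digraph" and C D :: "'v \<Rightarrow> 'e set set" +
  assumes C_partition: "v \<in> verts E \<Longrightarrow> partition_on {e \<in> arcs E. tail E e = v} (C v)"
    and D_partition: "v \<in> verts E \<Longrightarrow> partition_on {e \<in> arcs E. head E e = v} (D v)"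
    and C_finite: "X \<in> blocks E C \<Longrightarrow> finite X"
    and D_finite: "Y \<in> blocks E D \<Longrightarrow> finite Y"
    and meet_le_1: "X \<in> blocks E C \<Longrightarrow> Y \<in> blocks E D \<Longrightarrow> card (X \<inter> Y) \<le> 1"

locale rep_graph = bisep_graph E C D + F: conn_graph F
  for E :: "('v, 'e) pre_digraph" and C D :: "'v \<Rightarrow> 'e set set"
    and F :: "('w, 'f) pre_digraph" and \<phi>0 :: "'w \<Rightarrow> 'v" and \<phi>1 :: "'f \<Rightarrow> 'e" +
  assumes hom: "graph_hom F E \<phi>0 \<phi>1"
    and lift_C: "w \<in> verts F \<Longrightarrow> X \<in> C (\<phi>0 w) \<Longrightarrow>
      \<exists>!f. f \<in> arcs F \<and> tail F f = w \<and> \<phi>1 f \<in> X"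
    and lift_D: "w \<in> verts F \<Longrightarrow> Y \<in> D (\<phi>0 w) \<Longrightarrow>
      \<exists>!f. f \<in> arcs F \<and> head F f = w \<and> \<phi>1 f \<in> Y"

definition irreducible_rep ::
  "('w, 'f) pre_digraph \<Rightarrow> ('w \<Rightarrow> 'v) \<Rightarrow> ('f \<Rightarrow> 'e) \<Rightarrow> bool" where
  "irreducible_rep F \<phi>0 \<phi>1 \<longleftrightarrow>
     (\<forall>u\<in>verts F. \<forall>v\<in>verts F. u \<noteq> v \<longrightarrow>
        walk_map \<phi>0 \<phi>1 ` Walk_from F u \<noteq> walk_map \<phi>0 \<phi>1 ` Walk_from F v)"


section \<open>Algebras that need not be unital\<close>

record ('k, 'a) nalg =
  acarr :: "'a set"
  aadd :: "'a \<Rightarrow> 'a \<Rightarrow> 'a"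
  amult :: "'a \<Rightarrow> 'a \<Rightarrow> 'a"
  azero :: 'a
  ascale :: "'k \<Rightarrow> 'a \<Rightarrow> 'a"

definition alg_ideal :: "('k, 'a) nalg \<Rightarrow> 'a set \<Rightarrow> bool" where
  "alg_ideal A I \<longleftrightarrow> I \<subseteq> acarr A \<and> azero A \<in> I \<and>
     (\<forall>x\<in>I. \<forall>y\<in>I. aadd A x y \<in> I) \<and>
     (\<forall>k. \<forall>x\<in>I. ascale A k x \<in> I) \<and>
     (\<forall>a\<in>acarr A. \<forall>x\<in>I. amult A a x \<in> I \<and> amult A x a \<in> I)"

definition ideal_gen :: "('k, 'a) nalg \<Rightarrow> 'a set \<Rightarrow> 'a set" where
  "ideal_gen A S = \<Inter>{I. alg_ideal A I \<and> S \<subseteq> I}"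

definition coset :: "('k, 'a) nalg \<Rightarrow> 'a set \<Rightarrow> 'a \<Rightarrow> 'a set" where
  "coset A I x = aadd A x ` I"

definition quot_alg :: "('k, 'a) nalg \<Rightarrow> 'a set \<Rightarrow> ('k, 'a set) nalg" where
  "quot_alg A I =
    \<lparr> acarr = coset A I ` acarr A,
      aadd = (\<lambda>X Y. \<Union>x\<in>X. \<Union>y\<in>Y. coset A I (aadd A x y)),
      amult = (\<lambda>X Y. \<Union>x\<in>X. \<Union>y\<in>Y. coset A I (amult A x y)),
      azero = I,
      ascale = (\<lambda>k X. \<Union>x\<in>X. coset A I (ascale A k x)) \<rparr>"

definition alg_hom :: "('k, 'a) nalg \<Rightarrow> ('k, 'b) nalg \<Rightarrow> ('a \<Rightarrow> 'b) set" where
  "alg_hom A B = {h. (\<forall>x\<in>acarr A. h x \<in> acarr B) \<and>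
     (\<forall>x\<in>acarr A. \<forall>y\<in>acarr A. h (aadd A x y) = aadd B (h x) (h y)) \<and>
     (\<forall>x\<in>acarr A. \<forall>y\<in>acarr A. h (amult A x y) = amult B (h x) (h y)) \<and>
     (\<forall>k. \<forall>x\<in>acarr A. h (ascale A k x) = ascale B k (h x))}"

text \<open>The free non-unital algebra on a set \<open>S\<close>: its basis consists of the nonempty words over \<open>S\<close>.\<close>

definition pm_scale :: "'k::field \<Rightarrow> ('b \<Rightarrow>\<^sub>0 'k) \<Rightarrow> 'b \<Rightarrow>\<^sub>0 'k" where
  "pm_scale k p = Poly_Mapping.map ((*) k) p"

definition word_mult :: "('g list \<Rightarrow>\<^sub>0 'k::field) \<Rightarrow> ('g list \<Rightarrow>\<^sub>0 'k) \<Rightarrow> 'g list \<Rightarrow>\<^sub>0 'k" where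
  "word_mult p q = (\<Sum>a\<in>Poly_Mapping.keys p. \<Sum>b\<in>Poly_Mapping.keys q.
     Poly_Mapping.single (a @ b) (Poly_Mapping.lookup p a * Poly_Mapping.lookup q b))"

definition free_alg :: "'g set \<Rightarrow> ('k::field, 'g list \<Rightarrow>\<^sub>0 'k) nalg" where
  "free_alg S =
    \<lparr> acarr = {p. Poly_Mapping.keys p \<subseteq> {l. l \<noteq> [] \<and> set l \<subseteq> S}},
      aadd = (+), amult = word_mult, azero = 0, ascale = pm_scale \<rparr>"


section \<open>Path algebra and Leavitt path algebra\<close>

datatype ('v, 'd) gen = Vert 'v | Edge 'd

definition word :: "'g list \<Rightarrow> 'g list \<Rightarrow>\<^sub>0 'k::field" where
  "word l = Poly_Mapping.single l 1"

definition gens :: "('v, 'd) pre_digraph \<Rightarrow> ('v, 'd) gen set" where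
  "gens Q = Vert ` verts Q \<union> Edge ` arcs Q"

definition path_rels :: "('v, 'd) pre_digraph \<Rightarrow> (('v, 'd) gen list \<Rightarrow>\<^sub>0 'k::field) set" where
  "path_rels Q =
     {word [Vert u, Vert v] - (if u = v then word [Vert u] else 0) | u v.
        u \<in> verts Q \<and> v \<in> verts Q} \<union>
     {word [Vert (tail Q x), Edge x] - word [Edge x] | x. x \<in> arcs Q} \<union>
     {word [Edge x, Vert (head Q x)] - word [Edge x] | x. x \<in> arcs Q}"

definition path_ideal :: "('v, 'd) pre_digraph \<Rightarrow> (('v, 'd) gen list \<Rightarrow>\<^sub>0 'k::field) set" where
  "path_ideal Q = ideal_gen (free_alg (gens Q)) (path_rels Q)"

definition path_alg ::
  "('v, 'd) pre_digraph \<Rightarrow> ('k::field, (('v, 'd) gen list \<Rightarrow>\<^sub>0 'k) set) nalg" where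
  "path_alg Q = quot_alg (free_alg (gens Q)) (path_ideal Q)"

definition to_path_alg ::
  "('v, 'd) pre_digraph \<Rightarrow> (('v, 'd) gen list \<Rightarrow>\<^sub>0 'k::field) \<Rightarrow> (('v, 'd) gen list \<Rightarrow>\<^sub>0 'k) set" where
  "to_path_alg Q = coset (free_alg (gens Q)) (path_ideal Q)"

text \<open>
  \<open>meet2 a b X Y X' Y'\<close> is, for \<open>X \<inter> Y = {e}\<close> and \<open>X' \<inter> Y' = {e'}\<close>, the word formed by the
  edges \<open>a e\<close> and \<open>b e'\<close>; it is zero if one of the two intersections is empty. So
  $(XY)(YX')^*$ is \<open>meet2 Real Ghost X Y X' Y\<close> and $(YX)^*(XY')$ is
  \<open>meet2 Ghost Real X Y X Y'\<close>.
\<close>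

definition meet2 :: "('e \<Rightarrow> 'd) \<Rightarrow> ('e \<Rightarrow> 'd) \<Rightarrow> 'e set \<Rightarrow> 'e set \<Rightarrow> 'e set \<Rightarrow> 'e set
    \<Rightarrow> ('v, 'd) gen list \<Rightarrow>\<^sub>0 'k::field" where
  "meet2 a b X Y X' Y' =
     (if X \<inter> Y = {} \<or> X' \<inter> Y' = {} then 0
      else word [Edge (a (the_elem (X \<inter> Y))), Edge (b (the_elem (X' \<inter> Y')))])"

text \<open>
  The relations (L1) and (L2), written as elements of the free algebra on the generators of the
  path algebra. The sums, formally over all of $D$ (resp. $C$), are restricted to the finitely
  many blocks meeting \<open>X\<close> (resp. \<open>Y\<close>); all other summands are zero.
\<close>

definition leavitt_rels :: "('v, 'e) pre_digraph \<Rightarrow> ('v \<Rightarrow> 'e set set) \<Rightarrow> ('v \<Rightarrow> 'e set set)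
    \<Rightarrow> (('v, 'e dedge) gen list \<Rightarrow>\<^sub>0 'k::field) set" where
  "leavitt_rels E C D =
     {(\<Sum>Y\<in>{Y \<in> blocks E D. X \<inter> Y \<noteq> {}}. meet2 Real Ghost X Y X' Y)
        - (if X = X' then word [Vert (the_elem (tail E ` X))] else 0) | X X'.
        X \<in> blocks E C \<and> X' \<in> blocks E C} \<union>
     {(\<Sum>X\<in>{X \<in> blocks E C. X \<inter> Y \<noteq> {}}. meet2 Ghost Real X Y X Y')
        - (if Y = Y' then word [Vert (the_elem (head E ` Y))] else 0) | Y Y'.
        Y \<in> blocks E D \<and> Y' \<in> blocks E D}"

definition leavitt_ideal :: "('v, 'e) pre_digraph \<Rightarrow> ('v \<Rightarrow> 'e set set) \<Rightarrow> ('v \<Rightarrow> 'e set set)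
    \<Rightarrow> (('v, 'e dedge) gen list \<Rightarrow>\<^sub>0 'k::field) set set" where
  "leavitt_ideal E C D =
     ideal_gen (path_alg (double_graph E)) (to_path_alg (double_graph E) ` leavitt_rels E C D)"

type_synonym ('v, 'e, 'k) lpa = "(('v, 'e dedge) gen list \<Rightarrow>\<^sub>0 'k) set set"

definition leavitt_alg :: "('v, 'e) pre_digraph \<Rightarrow> ('v \<Rightarrow> 'e set set) \<Rightarrow> ('v \<Rightarrow> 'e set set)
    \<Rightarrow> ('k::field, ('v, 'e, 'k) lpa) nalg" where
  "leavitt_alg E C D = quot_alg (path_alg (double_graph E)) (leavitt_ideal E C D)"

definition lpa_gen :: "('v, 'e) pre_digraph \<Rightarrow> ('v \<Rightarrow> 'e set set) \<Rightarrow> ('v \<Rightarrow> 'e set set)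
    \<Rightarrow> ('v, 'e dedge) gen \<Rightarrow> ('v, 'e, 'k::field) lpa" where
  "lpa_gen E C D g =
     coset (path_alg (double_graph E)) (leavitt_ideal E C D)
       (to_path_alg (double_graph E) (word [g]))"

fun lpa_walk :: "('v, 'e) pre_digraph \<Rightarrow> ('v \<Rightarrow> 'e set set) \<Rightarrow> ('v \<Rightarrow> 'e set set)
    \<Rightarrow> 'v \<times> 'e dedge list \<Rightarrow> ('v, 'e, 'k::field) lpa" where
  "lpa_walk E C D (u, []) = lpa_gen E C D (Vert u)"
| "lpa_walk E C D (u, x # xs) =
     foldl (amult (leavitt_alg E C D)) (lpa_gen E C D (Edge x))
       (map (\<lambda>y. lpa_gen E C D (Edge y)) xs)"


section \<open>The module of a representation graph\<close>

definition Vsp :: "('w, 'f) pre_digraph \<Rightarrow> ('w \<Rightarrow>\<^sub>0 'k::field) set" where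
  "Vsp F = {x. Poly_Mapping.keys x \<subseteq> verts F}"

definition basis_vec :: "'w \<Rightarrow> 'w \<Rightarrow>\<^sub>0 'k::field" where
  "basis_vec w = Poly_Mapping.single w 1"

definition end_op :: "('b \<Rightarrow>\<^sub>0 'k::field) set \<Rightarrow> ('k, ('b \<Rightarrow>\<^sub>0 'k) \<Rightarrow> ('b \<Rightarrow>\<^sub>0 'k)) nalg" where
  "end_op V =
    \<lparr> acarr = {h \<in> V \<rightarrow>\<^sub>E V. (\<forall>x\<in>V. \<forall>y\<in>V. h (x + y) = h x + h y) \<and>
                (\<forall>k. \<forall>x\<in>V. h (pm_scale k x) = pm_scale k (h x))},
      aadd = (\<lambda>g h. \<lambda>x\<in>V. g x + h x),
      amult = (\<lambda>g h. \<lambda>x\<in>V. h (g x)),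
      azero = (\<lambda>x\<in>V. 0),
      ascale = (\<lambda>k h. \<lambda>x\<in>V. pm_scale k (h x)) \<rparr>"

definition lin_ext :: "('w, 'f) pre_digraph \<Rightarrow> ('w \<Rightarrow> 'w \<Rightarrow>\<^sub>0 'k::field)
    \<Rightarrow> ('w \<Rightarrow>\<^sub>0 'k) \<Rightarrow> ('w \<Rightarrow>\<^sub>0 'k)" where
  "lin_ext F b = (\<lambda>x\<in>Vsp F. \<Sum>w\<in>Poly_Mapping.keys x. pm_scale (Poly_Mapping.lookup x w) (b w))"

definition sigma_vert :: "('w, 'f) pre_digraph \<Rightarrow> ('w \<Rightarrow> 'v) \<Rightarrow> 'v
    \<Rightarrow> ('w \<Rightarrow>\<^sub>0 'k::field) \<Rightarrow> ('w \<Rightarrow>\<^sub>0 'k)" where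
  "sigma_vert F \<phi>0 v = lin_ext F (\<lambda>w. if \<phi>0 w = v then basis_vec w else 0)"

definition sigma_real :: "('w, 'f) pre_digraph \<Rightarrow> ('f \<Rightarrow> 'e) \<Rightarrow> 'e
    \<Rightarrow> ('w \<Rightarrow>\<^sub>0 'k::field) \<Rightarrow> ('w \<Rightarrow>\<^sub>0 'k)" where
  "sigma_real F \<phi>1 e = lin_ext F (\<lambda>w.
     if \<exists>f\<in>arcs F. tail F f = w \<and> \<phi>1 f = e
     then basis_vec (head F (THE f. f \<in> arcs F \<and> tail F f = w \<and> \<phi>1 f = e)) else 0)"

definition sigma_ghost :: "('w, 'f) pre_digraph \<Rightarrow> ('f \<Rightarrow> 'e) \<Rightarrow> 'e
    \<Rightarrow> ('w \<Rightarrow>\<^sub>0 'k::field) \<Rightarrow> ('w \<Rightarrow>\<^sub>0 'k)" where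
  "sigma_ghost F \<phi>1 e = lin_ext F (\<lambda>w.
     if \<exists>f\<in>arcs F. head F f = w \<and> \<phi>1 f = e
     then basis_vec (tail F (THE f. f \<in> arcs F \<and> head F f = w \<and> \<phi>1 f = e)) else 0)"

text \<open>
  The homomorphism is unique as a map on the carrier of the Leavitt path algebra;
  extensionality makes it unique as a total function, as the definite description requires.
\<close>

definition rep_hom :: "('v, 'e) pre_digraph \<Rightarrow> ('v \<Rightarrow> 'e set set) \<Rightarrow> ('v \<Rightarrow> 'e set set)
    \<Rightarrow> ('w, 'f) pre_digraph \<Rightarrow> ('w \<Rightarrow> 'v) \<Rightarrow> ('f \<Rightarrow> 'e)
    \<Rightarrow> ('v, 'e, 'k::field) lpa \<Rightarrow> ('w \<Rightarrow>\<^sub>0 'k) \<Rightarrow> ('w \<Rightarrow>\<^sub>0 'k)" where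
  "rep_hom E C D F \<phi>0 \<phi>1 = (THE \<pi>.
     \<pi> \<in> alg_hom (leavitt_alg E C D) (end_op (Vsp F)) \<and>
     \<pi> \<in> extensional (acarr (leavitt_alg E C D)) \<and>
     (\<forall>v\<in>verts E. \<pi> (lpa_gen E C D (Vert v)) = sigma_vert F \<phi>0 v) \<and>
     (\<forall>e\<in>arcs E. \<pi> (lpa_gen E C D (Edge (Real e))) = sigma_real F \<phi>1 e) \<and>
     (\<forall>e\<in>arcs E. \<pi> (lpa_gen E C D (Edge (Ghost e))) = sigma_ghost F \<phi>1 e))"

definition rep_act :: "('v, 'e) pre_digraph \<Rightarrow> ('v \<Rightarrow> 'e set set) \<Rightarrow> ('v \<Rightarrow> 'e set set)
    \<Rightarrow> ('w, 'f) pre_digraph \<Rightarrow> ('w \<Rightarrow> 'v) \<Rightarrow> ('f \<Rightarrow> 'e)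
    \<Rightarrow> ('w \<Rightarrow>\<^sub>0 'k::field) \<Rightarrow> ('v, 'e, 'k) lpa \<Rightarrow> ('w \<Rightarrow>\<^sub>0 'k)" where
  "rep_act E C D F \<phi>0 \<phi>1 x a = rep_hom E C D F \<phi>0 \<phi>1 a x"

text \<open>
  A right module is given by its carrier \<open>M\<close> and its action \<open>act\<close>. Submodules are additive
  subgroups closed under the action. They are not required to be closed under scalars of the
  base field, as usual for modules over a ring.
\<close>

definition right_submodule :: "('k, 'a) nalg \<Rightarrow> 'm::ab_group_add set \<Rightarrow> ('m \<Rightarrow> 'a \<Rightarrow> 'm)
    \<Rightarrow> 'm set \<Rightarrow> bool" where
  "right_submodule A M act U \<longleftrightarrow> U \<subseteq> M \<and> 0 \<in> U \<and>
     (\<forall>x\<in>U. \<forall>y\<in>U. x + y \<in> U) \<and> (\<forall>x\<in>U. - x \<in> U) \<and>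
     (\<forall>x\<in>U. \<forall>a\<in>acarr A. act x a \<in> U)"

definition simple_right_module ::
  "('k, 'a) nalg \<Rightarrow> 'm::ab_group_add set \<Rightarrow> ('m \<Rightarrow> 'a \<Rightarrow> 'm) \<Rightarrow> bool" where
  "simple_right_module A M act \<longleftrightarrow> M \<noteq> {0} \<and>
     (\<forall>U. right_submodule A M act U \<longrightarrow> U = {0} \<or> U = M)"

end

theory Submission
  imports Defs
begin

text \<open>
  A letter of the double graph of \<open>E\<close> acts on the vertices of \<open>F\<close> as a partial injection: from a
  vertex \<open>w\<close> it leads along the unique lift starting at \<open>w\<close>, if there is one. Hence a walk in \<open>E\<close>
  either kills a basis vector of $V(F,\phi)$ or sends it to another basis vector, distinct surviving
  basis vectors stay distinct, and the walk survives at \<open>w\<close> exactly if it is the image of a walk of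
  \<open>F\<close> starting at \<open>w\<close>. The whole theorem is read off from this combinatorial action.

  As to (i) and (ii): if $V(F,\phi)$ is simple, then $x.L$ is a submodule. It is nonzero, since for
  $s$ in the support of $x$ the vertex $\phi(s)$ preserves the coefficient of $x$ at $s$, so it contains
  a basis vector. Conversely a submodule containing a basis vector contains every scalar multiple of
  every other one, because walks of the connected graph $F$ lead from any vertex to any other.

  (ii) implies (iv): if $u \neq v$ have the same set of walk images, then every word survives at $u$
  iff it survives at $v$ (\<open>word_step_equiv\<close>). So the sum of the coefficients of $(u - v).a$ is zero
  for every $a$, whereas a basis vector has coefficient sum one.

  (iv) implies (iii): among the walks of $E$ that do not kill the support of $x$ completely, take one
  with the fewest survivors. Two survivors would end in distinct vertices, which irreducibility
  separates by a further walk, leaving fewer survivors. So exactly one remains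
  (\<open>isolate_vertex\<close>), and dividing by its coefficient gives a basis vector. As
  multiples of walks are elements of $L$, (iii) implies (ii).

  Before this, the module structure itself has to be established, since the action is introduced as
  the unique homomorphism with prescribed values on generators. The free algebra on the generators
  acts on $V(F,\phi)$ by linear extension (\<open>free_act\<close>); the defining relations act as zero
  (\<open>path_rels_act\<close>, \<open>leavitt_rels_act\<close>), so the action descends through the two quotients
  (\<open>quot_lift\<close>), and generators determine a homomorphism (\<open>free_alg_hom_eqI\<close>). In the end
  \<open>rep_act_class_of\<close> replaces the definite description by the concrete action.
\<close>

section \<open>Linear extension\<close>

lemma lookup_pm_scale [simp]: "Poly_Mapping.lookup (pm_scale k p) w = k * Poly_Mapping.lookup p w"
  by (simp add: pm_scale_def Poly_Mapping.map.rep_eq when_def)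

lemma pm_scale_add: "pm_scale k (p + q) = pm_scale k p + pm_scale k q"
  by (rule poly_mapping_eqI) (simp add: lookup_add algebra_simps)

lemma pm_scale_add_left: "pm_scale (k + l) p = pm_scale k p + pm_scale l p"
  by (rule poly_mapping_eqI) (simp add: lookup_add algebra_simps)

lemma pm_scale_pm_scale [simp]: "pm_scale k (pm_scale l p) = pm_scale (k * l) p"
  by (rule poly_mapping_eqI) (simp add: algebra_simps)

lemma pm_scale_zero [simp]: "pm_scale 0 p = 0" "pm_scale k 0 = 0"
  by (rule poly_mapping_eqI, simp)+

lemma pm_scale_one [simp]: "pm_scale 1 p = p"
  by (rule poly_mapping_eqI) simp

lemma pm_scale_minus_one [simp]: "pm_scale (- 1) p = - p"
  by (rule poly_mapping_eqI) simp

lemma pm_scale_single [simp]: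
  "pm_scale k (Poly_Mapping.single w c) = Poly_Mapping.single w (k * c)"
  by (rule poly_mapping_eqI) (simp add: lookup_single when_def)

lemma pm_scale_sum: "pm_scale k (\<Sum>a\<in>A. f a) = (\<Sum>a\<in>A. pm_scale k (f a))"
  by (induction A rule: infinite_finite_induct) (auto simp: pm_scale_add)

lemma keys_pm_scale: "Poly_Mapping.keys (pm_scale k p) \<subseteq> Poly_Mapping.keys p"
  by (auto simp: in_keys_iff)

definition lin :: "('a \<Rightarrow> 'b \<Rightarrow>\<^sub>0 'k::field) \<Rightarrow> ('a \<Rightarrow>\<^sub>0 'k) \<Rightarrow> 'b \<Rightarrow>\<^sub>0 'k" where
  "lin b x = (\<Sum>w\<in>Poly_Mapping.keys x. pm_scale (Poly_Mapping.lookup x w) (b w))"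

lemma lin_superset:
  assumes "finite A" "Poly_Mapping.keys x \<subseteq> A"
  shows "lin b x = (\<Sum>w\<in>A. pm_scale (Poly_Mapping.lookup x w) (b w))"
  unfolding lin_def using assms by (intro sum.mono_neutral_left) (auto simp: in_keys_iff)

lemma lin_cong:
  "(\<And>w. w \<in> Poly_Mapping.keys x \<Longrightarrow> b w = c w) \<Longrightarrow> lin b x = lin c x"
  by (simp add: lin_def)

lemma lin_add: "lin b (x + y) = lin b x + lin b y"
proof -
  let ?A = "Poly_Mapping.keys x \<union> Poly_Mapping.keys y"
  have "lin b (x + y) = (\<Sum>w\<in>?A. pm_scale (Poly_Mapping.lookup (x + y) w) (b w))"
    by (rule lin_superset) (auto intro: keys_add[THEN subsetD, THEN UnE])
  also have "\<dots> = (\<Sum>w\<in>?A. pm_scale (Poly_Mapping.lookup x w) (b w))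
      + (\<Sum>w\<in>?A. pm_scale (Poly_Mapping.lookup y w) (b w))"
    by (simp add: lookup_add pm_scale_add_left sum.distrib)
  also have "\<dots> = lin b x + lin b y"
    by (simp add: lin_superset[of ?A])
  finally show ?thesis .
qed

lemma lin_scale: "lin b (pm_scale k x) = pm_scale k (lin b x)"
  using lin_superset[of "Poly_Mapping.keys x" "pm_scale k x" b]
  by (simp add: keys_pm_scale lin_def pm_scale_sum)

lemma lin_zero [simp]: "lin b 0 = 0"
  by (simp add: lin_def)

lemma lin_uminus: "lin b (- x) = - lin b x"
  using lin_scale[of b "- 1" x] by simp

lemma lin_diff: "lin b (x - y) = lin b x - lin b y"
  using lin_add[of b x "- y"] by (simp add: lin_uminus)

lemma lin_sum: "lin b (\<Sum>i\<in>I. f i) = (\<Sum>i\<in>I. lin b (f i))"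
  by (induction I rule: infinite_finite_induct) (auto simp: lin_add)

lemma lin_single [simp]: "lin b (Poly_Mapping.single w c) = pm_scale c (b w)"
  by (cases "c = 0") (simp_all add: lin_def)

lemma lin_add_fun: "lin (\<lambda>w. b w + c w) x = lin b x + lin c x"
  by (simp add: lin_def pm_scale_add sum.distrib)

lemma lin_scale_fun: "lin (\<lambda>w. pm_scale k (b w)) x = pm_scale k (lin b x)"
  by (simp add: lin_def pm_scale_sum mult.commute)

lemma lin_lin: "lin c (lin b x) = lin (\<lambda>w. lin c (b w)) x"
  by (simp add: lin_def[of b] lin_def[of _ x] lin_sum lin_scale)

text \<open>
  The expression is bilinear in \<open>p\<close> and \<open>q\<close>, so the order of extension does not matter. This is what
  makes the action multiplicative, and what allows vanishing of an element of the free algebra to be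
  tested on basis vectors.
\<close>

lemma lin_swap: "lin (\<lambda>a. lin (f a) q) p = lin (\<lambda>b. lin (\<lambda>a. f a b) p) q"
  unfolding lin_def pm_scale_sum
  by (subst sum.swap) (simp add: mult.commute)

lemma lin_basis: "lin (\<lambda>w. Poly_Mapping.single w 1) x = x"
proof (rule poly_mapping_eqI)
  fix v
  show "Poly_Mapping.lookup (lin (\<lambda>w. Poly_Mapping.single w 1) x) v = Poly_Mapping.lookup x v"
    by (auto simp: lin_def lookup_sum lookup_single when_def in_keys_iff)
qed

lemma keys_lin:
  assumes "\<And>w. w \<in> Poly_Mapping.keys x \<Longrightarrow> Poly_Mapping.keys (b w) \<subseteq> S"
  shows "Poly_Mapping.keys (lin b x) \<subseteq> S"
proof -
  have "Poly_Mapping.keys (lin b x) \<subseteq> (\<Union>w\<in>Poly_Mapping.keys x. Poly_Mapping.keys (pm_scale (Poly_Mapping.lookup x w) (b w)))"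
    unfolding lin_def by (rule keys_sum)
  also have "\<dots> \<subseteq> S"
    by (intro UN_least order_trans[OF keys_pm_scale] assms)
  finally show ?thesis .
qed

section \<open>Quotients of algebras\<close>

text \<open>
  These laws make addition, multiplication and scaling of cosets of an ideal well defined: an additive
  group whose negation is scaling by \<open>- 1\<close>, with distributive multiplication and additive scaling.
  They pass to quotients, so that quotients can be iterated.
\<close>

locale nonassoc_algebra =
  fixes A :: "('k::field, 'a) nalg"
  assumes zero_closed [simp]: "azero A \<in> acarr A"
    and add_closed [simp]: "x \<in> acarr A \<Longrightarrow> y \<in> acarr A \<Longrightarrow> aadd A x y \<in> acarr A"
    and mult_closed [simp]: "x \<in> acarr A \<Longrightarrow> y \<in> acarr A \<Longrightarrow> amult A x y \<in> acarr A"
    and scale_closed [simp]: "x \<in> acarr A \<Longrightarrow> ascale A k x \<in> acarr A"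
    and add_assoc: "x \<in> acarr A \<Longrightarrow> y \<in> acarr A \<Longrightarrow> z \<in> acarr A \<Longrightarrow>
      aadd A (aadd A x y) z = aadd A x (aadd A y z)"
    and add_comm: "x \<in> acarr A \<Longrightarrow> y \<in> acarr A \<Longrightarrow> aadd A x y = aadd A y x"
    and add_zero [simp]: "x \<in> acarr A \<Longrightarrow> aadd A x (azero A) = x"
    and add_neg: "x \<in> acarr A \<Longrightarrow> aadd A x (ascale A (- 1) x) = azero A"
    and distrib_left: "x \<in> acarr A \<Longrightarrow> y \<in> acarr A \<Longrightarrow> z \<in> acarr A \<Longrightarrow>
      amult A x (aadd A y z) = aadd A (amult A x y) (amult A x z)"
    and distrib_right: "x \<in> acarr A \<Longrightarrow> y \<in> acarr A \<Longrightarrow> z \<in> acarr A \<Longrightarrow>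
      amult A (aadd A x y) z = aadd A (amult A x z) (amult A y z)"
    and scale_add: "x \<in> acarr A \<Longrightarrow> y \<in> acarr A \<Longrightarrow>
      ascale A k (aadd A x y) = aadd A (ascale A k x) (ascale A k y)"
begin

lemma add_left_comm:
  "x \<in> acarr A \<Longrightarrow> y \<in> acarr A \<Longrightarrow> z \<in> acarr A \<Longrightarrow>
    aadd A x (aadd A y z) = aadd A y (aadd A x z)"
  by (metis add_assoc add_comm)

lemmas add_ac = add_assoc add_comm add_left_comm

lemma zero_add [simp]: "x \<in> acarr A \<Longrightarrow> aadd A (azero A) x = x"
  by (metis add_comm add_zero zero_closed)

text \<open>
  Cancellation in the form in which it yields \<open>k 0 = 0\<close>, \<open>x 0 = 0\<close> and \<open>h 0 = 0\<close>: in each case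
  additivity shows that the element is its own double.
\<close>

lemma idem_is_zero:
  assumes "x \<in> acarr A" "aadd A x x = x" shows "x = azero A"
  by (metis add_assoc add_neg add_zero assms scale_closed)

lemma scale_zero [simp]: "ascale A k (azero A) = azero A"
  by (metis add_zero idem_is_zero scale_add scale_closed zero_closed)

lemma mult_zero [simp]:
  "x \<in> acarr A \<Longrightarrow> amult A x (azero A) = azero A"
  "x \<in> acarr A \<Longrightarrow> amult A (azero A) x = azero A"
   apply (metis add_zero idem_is_zero distrib_left mult_closed zero_closed)
  by (metis add_zero idem_is_zero distrib_right mult_closed zero_closed)

lemma alg_ideal_carrier: "alg_ideal A (acarr A)"
  by (simp add: alg_ideal_def)

lemma alg_ideal_ideal_gen:
  assumes "S \<subseteq> acarr A" shows "alg_ideal A (ideal_gen A S)"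
proof -
  have "ideal_gen A S \<subseteq> acarr A"
    using alg_ideal_carrier assms by (auto simp: ideal_gen_def)
  then show ?thesis
    unfolding alg_ideal_def ideal_gen_def by blast
qed

lemma coset_add_ideal:
  assumes I: "alg_ideal A I" and x: "x \<in> acarr A" and i: "i \<in> I"
  shows "coset A I (aadd A x i) = coset A I x"
proof -
  have IA: "I \<subseteq> acarr A" and add: "\<And>i j. i \<in> I \<Longrightarrow> j \<in> I \<Longrightarrow> aadd A i j \<in> I"
    and neg: "ascale A (- 1) i \<in> I"
    using I i by (auto simp: alg_ideal_def)
  have *: "aadd A (aadd A x i) j = aadd A x (aadd A i j)" if "j \<in> I" for j
    using IA that i x by (auto intro: add_assoc)
  have shift: "aadd A x j = aadd A (aadd A x i) (aadd A (ascale A (- 1) i) j)" if j: "j \<in> I" for j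
  proof -
    have "aadd A i (aadd A (ascale A (- 1) i) j) = j"
      using IA i j by (metis add_assoc add_neg neg subsetD zero_add)
    then show ?thesis using * add neg j by simp
  qed
  show ?thesis
    unfolding coset_def
  proof (intro equalityI image_subsetI)
    fix j assume "j \<in> I"
    then show "aadd A (aadd A x i) j \<in> aadd A x ` I" using * add[OF i] by simp
  next
    fix j assume j: "j \<in> I"
    show "aadd A x j \<in> aadd A (aadd A x i) ` I"
      using shift[OF j] add[OF neg j] by (rule image_eqI)
  qed
qed

text \<open>
  The operations of \<open>quot_alg\<close> are unions over all representatives. Since the ideal absorbs the error
  terms, all representatives yield the same coset and the unions collapse.
\<close>

lemma coset_quot:
  assumes I: "alg_ideal A I"
  shows "coset A I \<in> alg_hom A (quot_alg A I)"
proof -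
  have IA: "I \<subseteq> acarr A" and z: "azero A \<in> I"
    and add: "\<And>i j. i \<in> I \<Longrightarrow> j \<in> I \<Longrightarrow> aadd A i j \<in> I"
    and sc: "\<And>k i. i \<in> I \<Longrightarrow> ascale A k i \<in> I"
    and ml: "\<And>a i. a \<in> acarr A \<Longrightarrow> i \<in> I \<Longrightarrow> amult A a i \<in> I"
    and mr: "\<And>a i. a \<in> acarr A \<Longrightarrow> i \<in> I \<Longrightarrow> amult A i a \<in> I"
    using I by (auto simp: alg_ideal_def)
  note [simp] = IA[THEN subsetD]
  have self: "x \<in> coset A I x" if "x \<in> acarr A" for x
    using z that by (force simp: coset_def)
  have UNc: "(\<Union>y\<in>Y. f y) = c" if "y \<in> Y" "\<And>y. y \<in> Y \<Longrightarrow> f y = c" for Y y c and f :: "'a \<Rightarrow> 'a set"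
    using that by auto
  have k1: "coset A I (aadd A x' y') = coset A I (aadd A x y)"
    if "x \<in> acarr A" "y \<in> acarr A" "x' \<in> coset A I x" "y' \<in> coset A I y" for x y x' y'
  proof -
    from that obtain i j where ij: "i \<in> I" "x' = aadd A x i" "j \<in> I" "y' = aadd A y j"
      by (auto simp: coset_def)
    have "aadd A x' y' = aadd A (aadd A x y) (aadd A i j)"
      using that(1,2) ij by (simp add: add_ac)
    with coset_add_ideal[OF I] that(1,2) ij add show ?thesis by simp
  qed
  have 1: "aadd (quot_alg A I) (coset A I x) (coset A I y) = coset A I (aadd A x y)"
    if "x \<in> acarr A" "y \<in> acarr A" for x y
    unfolding quot_alg_def
    by simp (intro UNc[OF self[OF that(1)]] UNc[OF self[OF that(2)]] k1 that)
  have k2: "coset A I (amult A x' y') = coset A I (amult A x y)"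
    if "x \<in> acarr A" "y \<in> acarr A" "x' \<in> coset A I x" "y' \<in> coset A I y" for x y x' y'
  proof -
    from that obtain i j where ij: "i \<in> I" "x' = aadd A x i" "j \<in> I" "y' = aadd A y j"
      by (auto simp: coset_def)
    \<comment> \<open>the last three summands lie in \<open>I\<close>\<close>
    have "amult A x' y' = aadd A (amult A x y)
        (aadd A (amult A x j) (aadd A (amult A i y) (amult A i j)))"
      using that(1,2) ij by (simp add: distrib_left distrib_right add_ac)
    with coset_add_ideal[OF I] that(1,2) ij add ml mr show ?thesis by simp
  qed
  have 2: "amult (quot_alg A I) (coset A I x) (coset A I y) = coset A I (amult A x y)"
    if "x \<in> acarr A" "y \<in> acarr A" for x y
    unfolding quot_alg_def
    by simp (intro UNc[OF self[OF that(1)]] UNc[OF self[OF that(2)]] k2 that)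
  have k3: "coset A I (ascale A k x') = coset A I (ascale A k x)"
    if "x \<in> acarr A" "x' \<in> coset A I x" for x x' k
    using that coset_add_ideal[OF I] sc by (auto simp: coset_def[of A I x] scale_add)
  have 3: "ascale (quot_alg A I) k (coset A I x) = coset A I (ascale A k x)"
    if "x \<in> acarr A" for x k
    unfolding quot_alg_def
    by simp (intro UNc[OF self[OF that]] k3 that)
  show ?thesis
    unfolding alg_hom_def using 1 2 3 by (auto simp: quot_alg_def)
qed

lemma coset_zero: "alg_ideal A I \<Longrightarrow> coset A I (azero A) = I"
  unfolding coset_def alg_ideal_def by (auto simp: image_def subset_iff)

lemma nonassoc_algebra_hom_image:
  assumes h: "h \<in> alg_hom A B" and surj: "acarr B = h ` acarr A" and zero: "azero B = h (azero A)"
  shows "nonassoc_algebra B"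
proof -
  have [simp]: "x \<in> acarr A \<Longrightarrow> y \<in> acarr A \<Longrightarrow> aadd B (h x) (h y) = h (aadd A x y)"
    "x \<in> acarr A \<Longrightarrow> y \<in> acarr A \<Longrightarrow> amult B (h x) (h y) = h (amult A x y)"
    "x \<in> acarr A \<Longrightarrow> ascale B k (h x) = h (ascale A k x)" for x y k
    using h by (auto simp: alg_hom_def)
  show ?thesis
    by standard
      (auto simp: surj zero distrib_left distrib_right add_neg scale_add add_ac)
qed

lemma nonassoc_algebra_quot: "alg_ideal A I \<Longrightarrow> nonassoc_algebra (quot_alg A I)"
  by (rule nonassoc_algebra_hom_image[OF coset_quot]) (auto simp: coset_zero, auto simp: quot_alg_def)

end

lemma alg_hom_comp:
  "h \<in> alg_hom A B \<Longrightarrow> g \<in> alg_hom B C \<Longrightarrow> (\<lambda>x. g (h x)) \<in> alg_hom A C"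
  by (simp add: alg_hom_def)

lemma alg_hom_zero:
  assumes "nonassoc_algebra A" "nonassoc_algebra B" "h \<in> alg_hom A B"
  shows "h (azero A) = azero B"
proof -
  interpret A: nonassoc_algebra A by fact
  interpret B: nonassoc_algebra B by fact
  have "h (azero A) \<in> acarr B"
    using assms(3) by (simp add: alg_hom_def)
  moreover have "h (aadd A (azero A) (azero A)) = aadd B (h (azero A)) (h (azero A))"
    using assms(3) A.zero_closed unfolding alg_hom_def by blast
  ultimately show ?thesis using B.idem_is_zero by simp
qed

lemma alg_ideal_kernel:
  assumes "nonassoc_algebra A" "nonassoc_algebra B" "h \<in> alg_hom A B"
  shows "alg_ideal A {x \<in> acarr A. h x = azero B}"
proof -
  interpret A: nonassoc_algebra A by fact
  interpret B: nonassoc_algebra B by fact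
  show ?thesis
    using alg_hom_zero[OF assms] assms(3) unfolding alg_ideal_def alg_hom_def
    by (simp add: subset_iff)
qed

text \<open>
  The universal property of the quotient by a generated ideal: the kernel of \<open>h\<close> is an ideal
  containing \<open>S\<close>, hence contains the ideal generated by \<open>S\<close>, and \<open>h\<close> is constant on cosets.
\<close>

lemma quot_lift:
  assumes A: "nonassoc_algebra A" and B: "nonassoc_algebra B" and h: "h \<in> alg_hom A B"
    and S: "S \<subseteq> acarr A" and zero: "\<forall>x\<in>S. h x = azero B"
  shows "\<exists>h'\<in>alg_hom (quot_alg A (ideal_gen A S)) B.
    \<forall>x\<in>acarr A. h' (coset A (ideal_gen A S) x) = h x"
proof -
  interpret A: nonassoc_algebra A by fact
  interpret B: nonassoc_algebra B by fact
  let ?I = "ideal_gen A S"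
  have I: "alg_ideal A ?I" by (rule A.alg_ideal_ideal_gen[OF S])
  have ker: "h i = azero B" "i \<in> acarr A" if "i \<in> ?I" for i
    using that alg_ideal_kernel[OF A B h] S zero unfolding ideal_gen_def by blast+
  have const: "h y = h x" if "x \<in> acarr A" "y \<in> coset A ?I x" for x y
    using that ker h by (auto simp: coset_def alg_hom_def)
  have self: "x \<in> coset A ?I x" if "x \<in> acarr A" for x
    using I that by (force simp: coset_def alg_ideal_def)
  define h' where "h' X = h (SOME x. x \<in> X)" for X
  have h': "h' (coset A ?I x) = h x" if "x \<in> acarr A" for x
    unfolding h'_def by (rule const[OF that], rule someI, rule self[OF that])
  have q: "coset A ?I \<in> alg_hom A (quot_alg A ?I)" by (rule A.coset_quot[OF I])
  have carr: "acarr (quot_alg A ?I) = coset A ?I ` acarr A" by (simp add: quot_alg_def)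
  have "aadd (quot_alg A ?I) (coset A ?I x) (coset A ?I y) = coset A ?I (aadd A x y)"
    "amult (quot_alg A ?I) (coset A ?I x) (coset A ?I y) = coset A ?I (amult A x y)"
    "ascale (quot_alg A ?I) k (coset A ?I x) = coset A ?I (ascale A k x)"
    if "x \<in> acarr A" "y \<in> acarr A" for x y k
    using q that by (simp_all add: alg_hom_def)
  then have "h' \<in> alg_hom (quot_alg A ?I) B"
    using h h' unfolding alg_hom_def carr by simp
  then show ?thesis using h' by blast
qed

section \<open>The free algebra\<close>

lemma word_mult_lin: "word_mult p q = lin (\<lambda>a. lin (\<lambda>b. word (a @ b)) q) p"
  by (simp add: word_mult_def lin_def pm_scale_sum word_def)

lemma word_mult_word: "word_mult (word l) (word m) = word (l @ m)"
  by (simp add: word_mult_lin) (simp add: word_def)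

lemma nonassoc_algebra_free_alg: "nonassoc_algebra (free_alg S :: ('k::field, 'g list \<Rightarrow>\<^sub>0 'k) nalg)"
proof -
  define W where "W = {l. l \<noteq> [] \<and> set l \<subseteq> S}"
  have carr: "acarr (free_alg S) = {p :: 'g list \<Rightarrow>\<^sub>0 'k. Poly_Mapping.keys p \<subseteq> W}"
    by (simp add: free_alg_def W_def)
  have add: "Poly_Mapping.keys (p + q) \<subseteq> W"
    if "Poly_Mapping.keys p \<subseteq> W" "Poly_Mapping.keys q \<subseteq> W" for p q :: "'g list \<Rightarrow>\<^sub>0 'k"
    using that keys_add[of p q] by blast
  have scale: "Poly_Mapping.keys (pm_scale k p) \<subseteq> W"
    if "Poly_Mapping.keys p \<subseteq> W" for k and p :: "'g list \<Rightarrow>\<^sub>0 'k"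
    using that keys_pm_scale[of k p] by blast
  have mult: "Poly_Mapping.keys (word_mult p q) \<subseteq> W"
    if "Poly_Mapping.keys p \<subseteq> W" "Poly_Mapping.keys q \<subseteq> W" for p q :: "'g list \<Rightarrow>\<^sub>0 'k"
    unfolding word_mult_lin using that
    by (intro keys_lin) (auto simp: word_def W_def)
  show ?thesis
    by standard
      (simp_all add: carr add scale mult, simp_all add: free_alg_def add scale mult[unfolded word_mult_lin] pm_scale_add
         word_mult_lin lin_add lin_add_fun add_ac)
qed

lemma word_in_free_alg: "word l \<in> acarr (free_alg S) \<longleftrightarrow> l \<noteq> [] \<and> set l \<subseteq> S"
  by (simp add: free_alg_def word_def)

text \<open>
  Words are products of letters and span the free algebra.
\<close>

lemma free_alg_hom_eqI:
  fixes h :: "('g list \<Rightarrow>\<^sub>0 'k::field) \<Rightarrow> 'b"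
  assumes B: "nonassoc_algebra B" and h: "h \<in> alg_hom (free_alg S) B" and h': "h' \<in> alg_hom (free_alg S) B"
    and gens: "\<And>s. s \<in> S \<Longrightarrow> h (word [s]) = h' (word [s])"
    and p: "p \<in> acarr (free_alg S)"
  shows "h p = h' p"
proof -
  let ?A = "free_alg S :: ('k, _) nalg"
  interpret A: nonassoc_algebra ?A by (rule nonassoc_algebra_free_alg)
  have words: "h (word l) = h' (word l)" if "l \<noteq> []" "set l \<subseteq> S" for l
    using that
  proof (induction l rule: list_nonempty_induct)
    case (single s) then show ?case by (simp add: gens)
  next
    case (cons s l)
    then have "amult ?A (word [s]) (word l) = word (s # l)"
      by (simp add: free_alg_def word_mult_word)
    moreover have "word [s] \<in> acarr ?A" "word l \<in> acarr ?A"
      using cons by (auto simp: word_in_free_alg)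
    ultimately show ?case
      using h h' cons gens by (simp add: alg_hom_def) (metis insert_subset list.simps(15))
  qed
  let ?s = "\<lambda>T. \<Sum>l\<in>T. pm_scale (Poly_Mapping.lookup p l) (word l)"
  have "?s T \<in> acarr ?A \<and> h (?s T) = h' (?s T)" if "finite T" "T \<subseteq> Poly_Mapping.keys p" for T
    using that
  proof (induction T)
    case empty
    have "azero ?A = 0" by (simp add: free_alg_def)
    then show ?case
      using alg_hom_zero[OF A.nonassoc_algebra_axioms B h]
        alg_hom_zero[OF A.nonassoc_algebra_axioms B h'] A.zero_closed by simp
  next
    case (insert l T)
    let ?t = "ascale ?A (Poly_Mapping.lookup p l) (word l)"
    have l: "l \<noteq> []" "set l \<subseteq> S" using p insert.prems by (auto simp: free_alg_def)
    have w: "word l \<in> acarr ?A" using l by (simp add: word_in_free_alg)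
    have eq: "?s (insert l T) = aadd ?A ?t (?s T)"
      using insert.hyps by (simp add: free_alg_def)
    show ?case
      unfolding eq using w words[OF l] insert h h' by (auto simp: alg_hom_def)
  qed
  from this[of "Poly_Mapping.keys p"] show ?thesis
    using lin_basis[of p] by (simp add: lin_def word_def)
qed

section \<open>Lifting walks to a representation graph\<close>

lemma wf_digraph_double_graph:
  assumes "wf_digraph G" shows "wf_digraph (double_graph G)"
proof -
  interpret wf_digraph G by fact
  show ?thesis by standard (auto simp: double_graph_def)
qed

lemma verts_double_graph [simp]: "verts (double_graph G) = verts G"
  by (simp add: double_graph_def)

text \<open>
  A partial map on basis elements induces a linear map once "undefined" is read as the zero vector.
\<close>

definition vec_of :: "'w option \<Rightarrow> 'w \<Rightarrow>\<^sub>0 'k::field" where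
  "vec_of = case_option 0 basis_vec"

lemma vec_of_simps [simp]: "vec_of None = 0" "vec_of (Some w) = basis_vec w"
  by (simp_all add: vec_of_def)

context rep_graph
begin

text \<open>
  The maps $\sigma_e$ and $\sigma_{e^*}$ on basis vectors, as partial maps on the vertices of \<open>F\<close>. The
  case distinctions copy those of \<open>sigma_real\<close> and \<open>sigma_ghost\<close>; \<open>edge_step_iff\<close> gives the
  description used afterwards.
\<close>

definition edge_step :: "'e dedge \<Rightarrow> 'w \<Rightarrow> 'w option" where
  "edge_step d w = (case d of
     Real e \<Rightarrow> if \<exists>f\<in>arcs F. tail F f = w \<and> \<phi>1 f = e
       then Some (head F (THE f. f \<in> arcs F \<and> tail F f = w \<and> \<phi>1 f = e)) else None
   | Ghost e \<Rightarrow> if \<exists>f\<in>arcs F. head F f = w \<and> \<phi>1 f = e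
       then Some (tail F (THE f. f \<in> arcs F \<and> head F f = w \<and> \<phi>1 f = e)) else None)"

definition gen_step :: "('v, 'e dedge) gen \<Rightarrow> 'w \<Rightarrow> 'w option" where
  "gen_step g w = (case g of Vert v \<Rightarrow> if \<phi>0 w = v then Some w else None | Edge d \<Rightarrow> edge_step d w)"

primrec word_step :: "('v, 'e dedge) gen list \<Rightarrow> 'w \<Rightarrow> 'w option" where
  "word_step [] w = Some w"
| "word_step (g # l) w = Option.bind (gen_step g w) (word_step l)"

lemma gen_step_simps [simp]:
  "gen_step (Vert v) w = (if \<phi>0 w = v then Some w else None)"
  "gen_step (Edge d) w = edge_step d w"
  by (simp_all add: gen_step_def)

lemma word_step_append: "word_step (l @ m) w = Option.bind (word_step l w) (word_step m)"
proof (induction l arbitrary: w)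
  case (Cons g l)
  then show ?case by (cases "gen_step g w") simp_all
qed simp

lemma hom_arc:
  assumes "f \<in> arcs F"
  shows "\<phi>1 f \<in> arcs E" "tail E (\<phi>1 f) = \<phi>0 (tail F f)" "head E (\<phi>1 f) = \<phi>0 (head F f)"
  using hom assms by (auto simp: graph_hom_def)

lemma hom_vert: "w \<in> verts F \<Longrightarrow> \<phi>0 w \<in> verts E"
  using hom by (auto simp: graph_hom_def)

lemma C_cover: "e \<in> arcs E \<Longrightarrow> \<exists>X\<in>C (tail E e). e \<in> X"
  using partition_onD1[OF C_partition[of "tail E e"]] by auto

lemma D_cover: "e \<in> arcs E \<Longrightarrow> \<exists>Y\<in>D (head E e). e \<in> Y"
  using partition_onD1[OF D_partition[of "head E e"]] by auto

text \<open>
  The block of \<open>C\<close> containing the common image of the two arcs has a unique lift at their tail.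
\<close>

lemma arc_eq_if_tail_eq:
  assumes "f \<in> arcs F" "f' \<in> arcs F" "tail F f = tail F f'" "\<phi>1 f = \<phi>1 f'"
  shows "f = f'"
proof -
  obtain X where "X \<in> C (\<phi>0 (tail F f))" "\<phi>1 f \<in> X"
    using C_cover[of "\<phi>1 f"] hom_arc assms(1) by metis
  with lift_C[of "tail F f" X] assms show ?thesis
    by (metis F.tail_in_verts)
qed

lemma arc_eq_if_head_eq:
  assumes "f \<in> arcs F" "f' \<in> arcs F" "head F f = head F f'" "\<phi>1 f = \<phi>1 f'"
  shows "f = f'"
proof -
  obtain X where "X \<in> D (\<phi>0 (head F f))" "\<phi>1 f \<in> X"
    using D_cover[of "\<phi>1 f"] hom_arc assms(1) by metis
  with lift_D[of "head F f" X] assms show ?thesis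
    by (metis F.head_in_verts)
qed

lemma edge_step_Real_iff:
  "edge_step (Real e) w = Some w' \<longleftrightarrow> (\<exists>f\<in>arcs F. tail F f = w \<and> head F f = w' \<and> \<phi>1 f = e)"
proof (cases "\<exists>f\<in>arcs F. tail F f = w \<and> \<phi>1 f = e")
  case True
  then obtain f where f: "f \<in> arcs F" "tail F f = w" "\<phi>1 f = e" by blast
  then have "(THE f'. f' \<in> arcs F \<and> tail F f' = w \<and> \<phi>1 f' = e) = f"
    using arc_eq_if_tail_eq by (intro the_equality) metis+
  with True have "edge_step (Real e) w = Some (head F f)" by (simp add: edge_step_def)
  with f arc_eq_if_tail_eq show ?thesis by (metis option.inject)
next
  case False
  then have "edge_step (Real e) w = None" unfolding edge_step_def by (simp only: dedge.case if_False)
  with False show ?thesis by auto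
qed

lemma edge_step_Ghost_iff:
  "edge_step (Ghost e) w = Some w' \<longleftrightarrow> (\<exists>f\<in>arcs F. head F f = w \<and> tail F f = w' \<and> \<phi>1 f = e)"
proof (cases "\<exists>f\<in>arcs F. head F f = w \<and> \<phi>1 f = e")
  case True
  then obtain f where f: "f \<in> arcs F" "head F f = w" "\<phi>1 f = e" by blast
  then have "(THE f'. f' \<in> arcs F \<and> head F f' = w \<and> \<phi>1 f' = e) = f"
    using arc_eq_if_head_eq by (intro the_equality) metis+
  with True have "edge_step (Ghost e) w = Some (tail F f)" by (simp add: edge_step_def)
  with f arc_eq_if_head_eq show ?thesis by (metis option.inject)
next
  case False
  then have "edge_step (Ghost e) w = None" unfolding edge_step_def by (simp only: dedge.case if_False)
  with False show ?thesis by auto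
qed

lemma edge_step_iff:
  "edge_step d w = Some w' \<longleftrightarrow>
    (\<exists>x\<in>arcs (double_graph F). tail (double_graph F) x = w \<and> head (double_graph F) x = w' \<and>
      map_dedge \<phi>1 x = d)"
  by (cases d)
    (auto simp: edge_step_Real_iff edge_step_Ghost_iff double_graph_def bex_Un)

text \<open>
  Traversing an edge backwards is traversing its ghost, whose lifts are unique as well.
\<close>

lemma edge_step_inj:
  "edge_step d w = Some r \<Longrightarrow> edge_step d w' = Some r \<Longrightarrow> w = w'"
  using arc_eq_if_tail_eq arc_eq_if_head_eq
  by (cases d) (auto simp: edge_step_Real_iff edge_step_Ghost_iff)

lemma edge_step_double_graph:
  assumes "edge_step d w = Some w'"
  shows "w' \<in> verts F" "d \<in> arcs (double_graph E)"
    "tail (double_graph E) d = \<phi>0 w" "head (double_graph E) d = \<phi>0 w'"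
  using assms hom_arc
  by (cases d; auto simp: edge_step_Real_iff edge_step_Ghost_iff double_graph_def)+

lemma word_step_verts: "word_step l w = Some w' \<Longrightarrow> w \<in> verts F \<Longrightarrow> w' \<in> verts F"
proof (induction l arbitrary: w)
  case (Cons g l)
  then show ?case
    by (cases g) (auto simp: bind_eq_Some_conv edge_step_double_graph split: if_splits)
qed simp

lemma word_step_inj: "word_step l w = Some r \<Longrightarrow> word_step l w' = Some r \<Longrightarrow> w = w'"
proof (induction l arbitrary: w w')
  case (Cons g l)
  then show ?case
    by (cases g) (auto simp: bind_eq_Some_conv split: if_splits dest: edge_step_inj)
qed simp

lemma awalk_if_word_step:
  assumes "word_step (map Edge q) w = Some w'" "w \<in> verts F"
  shows "pre_digraph.awalk (double_graph E) (\<phi>0 w) q (\<phi>0 w')"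
  using assms
proof (induction q arbitrary: w)
  case Nil
  interpret dE: wf_digraph "double_graph E"
    by (rule wf_digraph_double_graph) unfold_locales
  show ?case using Nil hom_vert by (simp add: dE.awalk_Nil_iff)
next
  case (Cons d q)
  interpret dE: wf_digraph "double_graph E"
    by (rule wf_digraph_double_graph) unfold_locales
  from Cons.prems obtain u where u: "edge_step d w = Some u" "word_step (map Edge q) u = Some w'"
    by (auto simp: bind_eq_Some_conv)
  with Cons.IH[OF u(2)] edge_step_double_graph[OF u(1)] show ?case
    by (simp add: dE.awalk_Cons_iff)
qed

lemma word_step_image_walk:
  assumes "pre_digraph.awalk (double_graph F) w p w'"
  shows "word_step (map Edge (map (map_dedge \<phi>1) p)) w = Some w'"
  using assms
proof (induction p arbitrary: w)
  case Nil
  interpret dF: wf_digraph "double_graph F"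
    by (rule wf_digraph_double_graph) unfold_locales
  show ?case using Nil by (simp add: dF.awalk_Nil_iff)
next
  case (Cons x p)
  interpret dF: wf_digraph "double_graph F"
    by (rule wf_digraph_double_graph) unfold_locales
  from Cons.prems have "edge_step (map_dedge \<phi>1 x) w = Some (head (double_graph F) x)"
    unfolding edge_step_iff dF.awalk_Cons_iff by blast
  moreover have "word_step (map Edge (map (map_dedge \<phi>1) p)) (head (double_graph F) x) = Some w'"
    using Cons.prems by (intro Cons.IH) (simp add: dF.awalk_Cons_iff)
  ultimately show ?case by simp
qed

lemma lift_walk:
  assumes "word_step (map Edge q) w = Some w'" "w \<in> verts F"
  shows "\<exists>p. pre_digraph.awalk (double_graph F) w p w' \<and> map (map_dedge \<phi>1) p = q"
  using assms
proof (induction q arbitrary: w)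
  case Nil
  interpret dF: wf_digraph "double_graph F"
    by (rule wf_digraph_double_graph) unfold_locales
  have "pre_digraph.awalk (double_graph F) w [] w'" using Nil by (simp add: dF.awalk_Nil_iff)
  then show ?case by (intro exI[of _ "[]"] conjI) simp_all
next
  case (Cons d q)
  interpret dF: wf_digraph "double_graph F"
    by (rule wf_digraph_double_graph) unfold_locales
  from Cons.prems obtain u where u: "edge_step d w = Some u" "word_step (map Edge q) u = Some w'"
    by (auto simp: bind_eq_Some_conv)
  from Cons.IH[OF u(2) edge_step_double_graph(1)[OF u(1)]]
  obtain p where p: "pre_digraph.awalk (double_graph F) u p w'" "map (map_dedge \<phi>1) p = q"
    by metis
  obtain x where x: "x \<in> arcs (double_graph F)" "tail (double_graph F) x = w"
    "head (double_graph F) x = u" "map_dedge \<phi>1 x = d"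
    using u(1)[unfolded edge_step_iff] by metis
  have "pre_digraph.awalk (double_graph F) w (x # p) w'"
    unfolding dF.awalk_Cons_iff using x p(1) by simp
  moreover have "map (map_dedge \<phi>1) (x # p) = d # q"
    using x(4) p(2) by simp
  ultimately show ?case by (intro exI[of _ "x # p"] conjI)
qed

text \<open>
  The set compared in the definition of irreducibility consists of the walks that survive at \<open>u\<close>.
\<close>

lemma walk_image:
  assumes "u \<in> verts F"
  shows "walk_map \<phi>0 \<phi>1 ` Walk_from F u = {(\<phi>0 u, q) | q. word_step (map Edge q) u \<noteq> None}"
proof (intro equalityI subsetI)
  fix y assume "y \<in> walk_map \<phi>0 \<phi>1 ` Walk_from F u"
  then obtain p v where "y = (\<phi>0 u, map (map_dedge \<phi>1) p)" "pre_digraph.awalk (double_graph F) u p v"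
    by (auto simp: walk_map_def Walk_from_def Walk_def)
  with word_step_image_walk[of u p v] show "y \<in> {(\<phi>0 u, q) | q. word_step (map Edge q) u \<noteq> None}"
    by simp
next
  fix y assume "y \<in> {(\<phi>0 u, q) | q. word_step (map Edge q) u \<noteq> None}"
  then obtain q v where q: "y = (\<phi>0 u, q)" "word_step (map Edge q) u = Some v" by auto
  from lift_walk[OF q(2) assms] obtain p
    where "pre_digraph.awalk (double_graph F) u p v" "map (map_dedge \<phi>1) p = q" by blast
  then have "(u, p) \<in> Walk_from F u" "walk_map \<phi>0 \<phi>1 (u, p) = y"
    using q by (auto simp: walk_map_def Walk_from_def Walk_def)
  then show "y \<in> walk_map \<phi>0 \<phi>1 ` Walk_from F u" by blast
qed

text \<open>
  Having the same walk images is a bisimulation: a letter that survives at \<open>u\<close> is a walk of length one,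
  hence survives at \<open>v\<close>, and the two end points again have the same walk images, namely the remainders
  of the walks beginning with this letter. Vertices in the word only test the image in \<open>E\<close>, which the
  trivial walk shows to agree.
\<close>

lemma word_step_equiv:
  assumes "u \<in> verts F" "v \<in> verts F"
    and "walk_map \<phi>0 \<phi>1 ` Walk_from F u = walk_map \<phi>0 \<phi>1 ` Walk_from F v"
  shows "word_step l u = None \<longleftrightarrow> word_step l v = None"
proof -
  have iff: "a = \<phi>0 u \<and> word_step (map Edge q) u \<noteq> None \<longleftrightarrow>
      a = \<phi>0 v \<and> word_step (map Edge q) v \<noteq> None" for a q
  proof -
    have "(a, q) \<in> walk_map \<phi>0 \<phi>1 ` Walk_from F u \<longleftrightarrow> (a, q) \<in> walk_map \<phi>0 \<phi>1 ` Walk_from F v"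
      by (simp add: assms(3))
    then show ?thesis unfolding walk_image[OF assms(1)] walk_image[OF assms(2)] by simp
  qed
  have "\<phi>0 u = \<phi>0 v"
    using iff[of "\<phi>0 u" "[]"] by simp
  moreover from this have "word_step (map Edge q) u = None \<longleftrightarrow> word_step (map Edge q) v = None" for q
    using iff[of "\<phi>0 u" q] by argo
  ultimately have "\<phi>0 u = \<phi>0 v \<and>
      (\<forall>q. word_step (map Edge q) u = None \<longleftrightarrow> word_step (map Edge q) v = None)"
    by simp
  then show ?thesis
  proof (induction l arbitrary: u v)
    case (Cons g l)
    then have eq: "\<phi>0 u = \<phi>0 v"
      and none: "\<And>q. word_step (map Edge q) u = None \<longleftrightarrow> word_step (map Edge q) v = None"
      by auto
    show ?case
    proof (cases g)
      case (Vert a)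
      then show ?thesis using Cons by simp
    next
      case (Edge d)
      show ?thesis
      proof (cases "edge_step d u")
        case None
        then show ?thesis using none[of "[d]"] Edge by (cases "edge_step d v") simp_all
      next
        case (Some u')
        then obtain v' where v': "edge_step d v = Some v'"
          using none[of "[d]"] by (cases "edge_step d v") simp_all
        have "\<phi>0 u' = \<phi>0 v'"
          using edge_step_double_graph(4)[OF Some] edge_step_double_graph(4)[OF v'] by simp
        moreover have "word_step (map Edge q) u' = None \<longleftrightarrow> word_step (map Edge q) v' = None" for q
          using none[of "d # q"] Some v' by simp
        ultimately show ?thesis using Cons.IH Edge Some v' by simp
      qed
    qed
  qed simp
qed

lemma phi_word_step_eq:
  "word_step (map Edge q) s = Some s' \<Longrightarrow> word_step (map Edge q) t = Some t' \<Longrightarrow>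
    \<phi>0 s = \<phi>0 t \<Longrightarrow> \<phi>0 s' = \<phi>0 t'"
proof (induction q arbitrary: s t)
  case (Cons d q)
  then obtain u v where "edge_step d s = Some u" "word_step (map Edge q) u = Some s'"
    "edge_step d t = Some v" "word_step (map Edge q) v = Some t'"
    by (auto simp: bind_eq_Some_conv)
  with Cons.IH edge_step_double_graph(4) show ?case by metis
qed simp

text \<open>
  The walk is chosen with as few survivors in \<open>S\<close> as possible, but at least one. If two vertices
  survived, injectivity would keep their end points distinct, and by irreducibility some walk survives
  at exactly one of these; appending it would leave fewer survivors. The leading vertex
  \<open>Vert (\<phi>0 s)\<close> makes the statement correct for the trivial walk, whose list of edges kills nothing.
\<close>

lemma isolate_vertex:
  assumes irr: "irreducible_rep F \<phi>0 \<phi>1" and S: "finite S" "S \<noteq> {}" "S \<subseteq> verts F"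
  obtains s q where "{s'\<in>S. word_step (Vert (\<phi>0 s) # map Edge q) s' \<noteq> None} = {s}"
proof -
  define T where "T a q = {s\<in>S. word_step (Vert a # map Edge q) s \<noteq> None}" for a q
  have fin: "finite (T a q)" for a q using S(1) by (simp add: T_def)
  obtain s0 where "s0 \<in> S" using S by blast
  then have "s0 \<in> T (\<phi>0 s0) []" by (simp add: T_def)
  then have "T (fst (\<phi>0 s0, [])) (snd (\<phi>0 s0, [])) \<noteq> {}" by auto
  from ex_has_least_nat[of "\<lambda>z. T (fst z) (snd z) \<noteq> {}", OF this, of "\<lambda>z. card (T (fst z) (snd z))"]
  obtain a q where ne: "T a q \<noteq> {}"
    and least: "\<forall>y. T (fst y) (snd y) \<noteq> {} \<longrightarrow> card (T a q) \<le> card (T (fst y) (snd y))"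
    by (metis surjective_pairing)
  have min: "T b r \<noteq> {} \<Longrightarrow> card (T a q) \<le> card (T b r)" for b r
    using least[rule_format, of "(b, r)"] by simp
  \<comment> \<open>a walk separating two end points contradicts minimality\<close>
  have unsep: False if s: "s \<in> T a q" and t: "t \<in> T a q"
    and s': "word_step (map Edge q) s = Some s'" and t': "word_step (map Edge q) t = Some t'"
    and r: "word_step (map Edge r) s' \<noteq> None" "word_step (map Edge r) t' = None" for s t s' t' r
  proof -
    have "T a (q @ r) \<subseteq> T a q"
    proof
      fix x assume "x \<in> T a (q @ r)"
      then show "x \<in> T a q"
        by (cases "word_step (map Edge q) x"; cases "\<phi>0 x = a") (auto simp: T_def word_step_append)
    qed
    moreover have "t \<notin> T a (q @ r)" "s \<in> T a (q @ r)"
      using s t s' t' r by (auto simp: T_def word_step_append split: if_splits)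
    ultimately have "T a (q @ r) \<subset> T a q" "T a (q @ r) \<noteq> {}" using t by blast+
    with min[of a "q @ r"] psubset_card_mono[OF fin, of "T a (q @ r)" a q] show False by linarith
  qed
  have "s = t" if s: "s \<in> T a q" and t: "t \<in> T a q" for s t
  proof (rule ccontr)
    assume "s \<noteq> t"
    from s t obtain s' t' where st: "word_step (map Edge q) s = Some s'"
      "word_step (map Edge q) t = Some t'" "\<phi>0 s = \<phi>0 t" "s \<in> verts F" "t \<in> verts F"
      using S(3) by (auto simp: T_def split: if_splits)
    then have "s' \<noteq> t'" "s' \<in> verts F" "t' \<in> verts F"
      using \<open>s \<noteq> t\<close> word_step_inj word_step_verts by blast+
    then have "walk_map \<phi>0 \<phi>1 ` Walk_from F s' \<noteq> walk_map \<phi>0 \<phi>1 ` Walk_from F t'"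
      using irr by (auto simp: irreducible_rep_def)
    then have "\<not> (\<forall>r. word_step (map Edge r) s' = None \<longleftrightarrow> word_step (map Edge r) t' = None)"
      unfolding walk_image[OF \<open>s' \<in> verts F\<close>] walk_image[OF \<open>t' \<in> verts F\<close>]
        phi_word_step_eq[OF st(1-3)] by (rule contrapos_nn) (simp del: not_None_eq)
    then obtain r where "word_step (map Edge r) s' = None \<longleftrightarrow> word_step (map Edge r) t' \<noteq> None"
      by blast
    then show False
      using unsep[OF s t st(1,2)] unsep[OF t s st(2,1)] by blast
  qed
  with ne obtain s where sing: "T a q = {s}" by blast
  then have "a = \<phi>0 s" by (auto simp: T_def split: if_splits)
  with sing that[of s q] show thesis by (simp add: T_def)
qed

end

section \<open>The defining relations hold in the module\<close>

context rep_graph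
begin

text \<open>
  The identities (L1) and (L2) on a basis vector \<open>w\<close>, treated together: for (L1) \<open>t\<close> and \<open>h\<close> are tail
  and head of \<open>F\<close>, \<open>\<X>\<close> and \<open>\<Y>\<close> the blocks of \<open>C\<close> and \<open>D\<close>; for (L2) all roles are exchanged. If
  \<open>X\<close> has no lift at \<open>w\<close>, all terms vanish. Otherwise let \<open>f\<close> be its unique lift there. Only the block \<open>Y0\<close> containing its image contributes to the
  sum. The only lift of \<open>Y0\<close> at \<open>h f\<close> is \<open>f\<close> itself, so the way back exists only if the image of
  \<open>f\<close> lies in \<open>X'\<close>, which by disjointness means \<open>X = X'\<close>, and it returns to \<open>w\<close>.
\<close>

lemma cancel_blocks:
  fixes a b :: "'e \<Rightarrow> 'e dedge" and t h :: "'f \<Rightarrow> 'w" and \<X> \<Y> :: "'e set set"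
  assumes step_a: "\<And>e w w'. edge_step (a e) w = Some w' \<longleftrightarrow> (\<exists>f\<in>arcs F. t f = w \<and> h f = w' \<and> \<phi>1 f = e)"
    and step_b: "\<And>e w w'. edge_step (b e) w = Some w' \<longleftrightarrow> (\<exists>f\<in>arcs F. h f = w \<and> t f = w' \<and> \<phi>1 f = e)"
    and disj_X: "\<And>e X X'. X \<in> \<X> \<Longrightarrow> X' \<in> \<X> \<Longrightarrow> e \<in> X \<Longrightarrow> e \<in> X' \<Longrightarrow> X = X'"
    and disj_Y: "\<And>e Y Y'. Y \<in> \<Y> \<Longrightarrow> Y' \<in> \<Y> \<Longrightarrow> e \<in> Y \<Longrightarrow> e \<in> Y' \<Longrightarrow> Y = Y'"
    and fin: "\<And>X. X \<in> \<X> \<Longrightarrow> finite X"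
    and meet: "\<And>X Y. X \<in> \<X> \<Longrightarrow> Y \<in> \<Y> \<Longrightarrow> card (X \<inter> Y) \<le> 1"
    and cover: "\<And>f. f \<in> arcs F \<Longrightarrow> \<exists>Y\<in>\<Y>. \<phi>1 f \<in> Y"
    and uniq_X: "\<And>X f f'. X \<in> \<X> \<Longrightarrow> f \<in> arcs F \<Longrightarrow> f' \<in> arcs F \<Longrightarrow> t f = t f' \<Longrightarrow>
      \<phi>1 f \<in> X \<Longrightarrow> \<phi>1 f' \<in> X \<Longrightarrow> f = f'"
    and uniq_Y: "\<And>Y f f'. Y \<in> \<Y> \<Longrightarrow> f \<in> arcs F \<Longrightarrow> f' \<in> arcs F \<Longrightarrow> h f = h f' \<Longrightarrow>
      \<phi>1 f \<in> Y \<Longrightarrow> \<phi>1 f' \<in> Y \<Longrightarrow> f = f'"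
    and X: "X \<in> \<X>" and X': "X' \<in> \<X>"
  shows "(\<Sum>Y\<in>{Y\<in>\<Y>. X \<inter> Y \<noteq> {}}. if X \<inter> Y = {} \<or> X' \<inter> Y = {} then 0
      else vec_of (word_step [Edge (a (the_elem (X \<inter> Y))), Edge (b (the_elem (X' \<inter> Y)))] w))
    = (if X = X' \<and> (\<exists>f\<in>arcs F. t f = w \<and> \<phi>1 f \<in> X) then basis_vec w else (0 :: 'w \<Rightarrow>\<^sub>0 'k::field))"
    (is "sum ?g ?I = _")
proof -
  have the_meet: "the_elem (Z \<inter> Y) = e" if "Z \<in> \<X>" "Y \<in> \<Y>" "e \<in> Z" "e \<in> Y" for Z Y e
  proof -
    have "finite (Z \<inter> Y)" "card (Z \<inter> Y) \<le> Suc 0" "e \<in> Z \<inter> Y" using that fin meet by simp_all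
    then have "Z \<inter> Y = {e}" using card_le_Suc0_iff_eq[of "Z \<inter> Y"] by blast
    then show ?thesis by simp
  qed
  \<comment> \<open>the sum is not degenerate: each edge of \<open>X\<close> lies in only one block of \<open>\<Y>\<close>\<close>
  have finI: "finite ?I"
  proof -
    have "?I \<subseteq> (\<lambda>e. THE Y. Y \<in> \<Y> \<and> e \<in> Y) ` X"
    proof
      fix Y assume "Y \<in> ?I"
      then obtain e where e: "Y \<in> \<Y>" "e \<in> X" "e \<in> Y" by blast
      then have "(THE Y. Y \<in> \<Y> \<and> e \<in> Y) = Y" using disj_Y by (intro the_equality) metis+
      with e(2) show "Y \<in> (\<lambda>e. THE Y. Y \<in> \<Y> \<and> e \<in> Y) ` X" by (intro image_eqI[of _ _ e]) simp_all
    qed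
    then show ?thesis by (rule finite_surj[OF fin[OF X]])
  qed
  have first: "edge_step (a (the_elem (X \<inter> Y))) w = None"
    if "Y \<in> ?I" "\<And>f. f \<in> arcs F \<Longrightarrow> t f = w \<Longrightarrow> \<phi>1 f \<in> X \<Longrightarrow> \<phi>1 f \<notin> Y" for Y
  proof -
    from that(1) obtain e where e: "Y \<in> \<Y>" "e \<in> X" "e \<in> Y" by blast
    have "edge_step (a e) w \<noteq> Some w'" for w'
      unfolding step_a using that(2) e(2,3) by blast
    then have "edge_step (a e) w = None" by (cases "edge_step (a e) w") blast+
    then show ?thesis by (simp add: the_meet[OF X e(1,2,3)])
  qed
  show ?thesis
  proof (cases "\<exists>f\<in>arcs F. t f = w \<and> \<phi>1 f \<in> X")
    case False
    then have "?g Y = 0" if "Y \<in> ?I" for Y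
      using first[OF that] by auto
    then have "sum ?g ?I = 0" by (intro sum.neutral) blast
    moreover have "\<not> (X = X' \<and> (\<exists>f\<in>arcs F. t f = w \<and> \<phi>1 f \<in> X))" using False by blast
    ultimately show ?thesis by (simp only: if_False)
  next
    case True
    then obtain f where f: "f \<in> arcs F" "t f = w" "\<phi>1 f \<in> X" by blast
    then obtain Y0 where Y0: "Y0 \<in> \<Y>" "\<phi>1 f \<in> Y0" using cover by blast
    have "?g Y = 0" if Y: "Y \<in> ?I - {Y0}" for Y
    proof -
      have "\<phi>1 f' \<notin> Y" if "f' \<in> arcs F" "t f' = w" "\<phi>1 f' \<in> X" for f'
      proof -
        have "f' = f" using uniq_X[OF X] f that by simp
        then show ?thesis using Y disj_Y[OF _ Y0(1) _ Y0(2)] by blast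
      qed
      then have "edge_step (a (the_elem (X \<inter> Y))) w = None" using Y by (intro first) auto
      then show ?thesis by simp
    qed
    then have "sum ?g ?I = sum ?g {Y0}"
      using f Y0 by (intro sum.mono_neutral_right finI) auto
    also have "\<dots> = ?g Y0" by simp
    also have "\<dots> = (if X = X' then basis_vec w else 0)"
    proof (cases "X' \<inter> Y0 = {}")
      case True
      then have "X \<noteq> X'" using f Y0 by auto
      with True show ?thesis by simp
    next
      case False
      then obtain e' where e': "e' \<in> X'" "e' \<in> Y0" by blast
      have step1: "edge_step (a (\<phi>1 f)) w = Some (h f)"
        unfolding step_a using f by blast
      have step2: "edge_step (b e') (h f) = Some w' \<longleftrightarrow> e' = \<phi>1 f \<and> w' = w" for w'
      proof
        assume "edge_step (b e') (h f) = Some w'"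
        then obtain f' where f': "f' \<in> arcs F" "h f' = h f" "t f' = w'" "\<phi>1 f' = e'"
          unfolding step_b by blast
        then have "f' = f" using uniq_Y[OF Y0(1) f'(1) f(1)] e'(2) Y0(2) by simp
        with f f' show "e' = \<phi>1 f \<and> w' = w" by simp
      next
        assume "e' = \<phi>1 f \<and> w' = w"
        with f show "edge_step (b e') (h f) = Some w'" unfolding step_b by blast
      qed
      have "edge_step (b e') (h f) = (if X = X' then Some w else None)"
      proof (cases "X = X'")
        case True
        then have "e' = \<phi>1 f"
          using the_meet[OF X Y0(1) f(3) Y0(2)] the_meet[OF X' Y0(1) e'] by simp
        with step2[of w] True show ?thesis by simp
      next
        case neq: False
        then have "e' \<noteq> \<phi>1 f" using disj_X[OF X X' f(3)] e' by blast
        with step2 neq show ?thesis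
          by (cases "edge_step (b e') (h f)") (simp_all, blast)
      qed
      moreover have "the_elem (X \<inter> Y0) = \<phi>1 f" "the_elem (X' \<inter> Y0) = e'"
        using the_meet[OF X Y0(1) f(3) Y0(2)] the_meet[OF X' Y0(1) e'] by simp_all
      moreover have "X \<inter> Y0 \<noteq> {}" using f Y0 by blast
      ultimately show ?thesis using False step1 by simp
    qed
    finally show ?thesis using True by (simp only: simp_thms)
  qed
qed

lemma block_C:
  assumes "X \<in> blocks E C"
  shows "X \<subseteq> arcs E"
    "\<exists>v\<in>verts E. X \<in> C v \<and> (\<forall>e\<in>X. tail E e = v) \<and> the_elem (tail E ` X) = v"
proof -
  obtain v where v: "v \<in> verts E" "X \<in> C v" using assms by (auto simp: blocks_def)
  from partition_onD1[OF C_partition[OF v(1)]] v(2)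
  have 1: "X \<subseteq> {e \<in> arcs E. tail E e = v}" by blast
  from partition_onD3[OF C_partition[OF v(1)]] v(2) have 2: "X \<noteq> {}" by blast
  from 1 2 have "tail E ` X = {v}" by auto
  with v 1 2 show "X \<subseteq> arcs E"
    "\<exists>v\<in>verts E. X \<in> C v \<and> (\<forall>e\<in>X. tail E e = v) \<and> the_elem (tail E ` X) = v"
    by auto
qed

lemma block_D:
  assumes "X \<in> blocks E D"
  shows "X \<subseteq> arcs E"
    "\<exists>v\<in>verts E. X \<in> D v \<and> (\<forall>e\<in>X. head E e = v) \<and> the_elem (head E ` X) = v"
proof -
  obtain v where v: "v \<in> verts E" "X \<in> D v" using assms by (auto simp: blocks_def)
  from partition_onD1[OF D_partition[OF v(1)]] v(2)
  have 1: "X \<subseteq> {e \<in> arcs E. head E e = v}" by blast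
  from partition_onD3[OF D_partition[OF v(1)]] v(2) have 2: "X \<noteq> {}" by blast
  from 1 2 have "head E ` X = {v}" by auto
  with v 1 2 show "X \<subseteq> arcs E"
    "\<exists>v\<in>verts E. X \<in> D v \<and> (\<forall>e\<in>X. head E e = v) \<and> the_elem (head E ` X) = v"
    by auto
qed

lemma block_C_disjoint:
  assumes "X \<in> blocks E C" "X' \<in> blocks E C" "e \<in> X" "e \<in> X'" shows "X = X'"
proof -
  from block_C(2)[OF assms(1)] block_C(2)[OF assms(2)] assms(3,4)
  obtain v where "v \<in> verts E" "X \<in> C v" "X' \<in> C v" by metis
  then show ?thesis
    using partition_onD2[OF C_partition] assms(3,4) by (meson disjointD disjoint_iff)
qed

lemma block_D_disjoint:
  assumes "X \<in> blocks E D" "X' \<in> blocks E D" "e \<in> X" "e \<in> X'" shows "X = X'"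
proof -
  from block_D(2)[OF assms(1)] block_D(2)[OF assms(2)] assms(3,4)
  obtain v where "v \<in> verts E" "X \<in> D v" "X' \<in> D v" by metis
  then show ?thesis
    using partition_onD2[OF D_partition] assms(3,4) by (meson disjointD disjoint_iff)
qed

lemma block_C_cover: "f \<in> arcs F \<Longrightarrow> \<exists>X\<in>blocks E C. \<phi>1 f \<in> X"
  using C_cover[OF hom_arc(1)] tail_in_verts[OF hom_arc(1)] by (fastforce simp: blocks_def)

lemma block_D_cover: "f \<in> arcs F \<Longrightarrow> \<exists>X\<in>blocks E D. \<phi>1 f \<in> X"
  using D_cover[OF hom_arc(1)] head_in_verts[OF hom_arc(1)] by (fastforce simp: blocks_def)

lemma block_C_lift_unique:
  assumes "X \<in> blocks E C" "f \<in> arcs F" "f' \<in> arcs F" "tail F f = tail F f'" "\<phi>1 f \<in> X" "\<phi>1 f' \<in> X"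
  shows "f = f'"
proof -
  have "X \<in> C (\<phi>0 (tail F f))"
    using block_C(2)[OF assms(1)] assms(2,5) hom_arc(2) by metis
  from lift_C[OF F.tail_in_verts[OF assms(2)] this] assms show ?thesis by metis
qed

lemma block_D_lift_unique:
  assumes "X \<in> blocks E D" "f \<in> arcs F" "f' \<in> arcs F" "head F f = head F f'" "\<phi>1 f \<in> X" "\<phi>1 f' \<in> X"
  shows "f = f'"
proof -
  have "X \<in> D (\<phi>0 (head F f))"
    using block_D(2)[OF assms(1)] assms(2,5) hom_arc(3) by metis
  from lift_D[OF F.head_in_verts[OF assms(2)] this] assms show ?thesis by metis
qed

text \<open>
  A lift of \<open>X\<close> at \<open>w\<close> exists exactly where the vertex on the right-hand side of (L1) acts as the
  identity.
\<close>

lemma block_C_lift_iff: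
  assumes "X \<in> blocks E C" "w \<in> verts F"
  shows "(\<exists>f\<in>arcs F. tail F f = w \<and> \<phi>1 f \<in> X) \<longleftrightarrow> \<phi>0 w = the_elem (tail E ` X)"
proof -
  obtain v where v: "X \<in> C v" "\<forall>e\<in>X. tail E e = v" "the_elem (tail E ` X) = v"
    using block_C(2)[OF assms(1)] by blast
  show ?thesis
  proof
    assume "\<phi>0 w = the_elem (tail E ` X)"
    then have "X \<in> C (\<phi>0 w)" using v by simp
    from ex1_implies_ex[OF lift_C[OF assms(2) this]] show "\<exists>f\<in>arcs F. tail F f = w \<and> \<phi>1 f \<in> X" by blast
  qed (use v hom_arc(2) in auto)
qed

lemma block_D_lift_iff:
  assumes "X \<in> blocks E D" "w \<in> verts F"
  shows "(\<exists>f\<in>arcs F. head F f = w \<and> \<phi>1 f \<in> X) \<longleftrightarrow> \<phi>0 w = the_elem (head E ` X)"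
proof -
  obtain v where v: "X \<in> D v" "\<forall>e\<in>X. head E e = v" "the_elem (head E ` X) = v"
    using block_D(2)[OF assms(1)] by blast
  show ?thesis
  proof
    assume "\<phi>0 w = the_elem (head E ` X)"
    then have "X \<in> D (\<phi>0 w)" using v by simp
    from ex1_implies_ex[OF lift_D[OF assms(2) this]] show "\<exists>f\<in>arcs F. head F f = w \<and> \<phi>1 f \<in> X" by blast
  qed (use v hom_arc(3) in auto)
qed

lemma cancel_C:
  assumes "X \<in> blocks E C" "X' \<in> blocks E C"
  shows "(\<Sum>Y\<in>{Y\<in>blocks E D. X \<inter> Y \<noteq> {}}. if X \<inter> Y = {} \<or> X' \<inter> Y = {} then 0
      else vec_of (word_step [Edge (Real (the_elem (X \<inter> Y))), Edge (Ghost (the_elem (X' \<inter> Y)))] w))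
    = (if X = X' \<and> (\<exists>f\<in>arcs F. tail F f = w \<and> \<phi>1 f \<in> X) then basis_vec w else (0 :: 'w \<Rightarrow>\<^sub>0 'k::field))"
  by (rule cancel_blocks[where t = "tail F" and h = "head F" and \<X> = "blocks E C" and \<Y> = "blocks E D"])
    (fact edge_step_Real_iff edge_step_Ghost_iff block_C_disjoint block_D_disjoint C_finite meet_le_1
      block_D_cover block_C_lift_unique block_D_lift_unique assms)+

lemma cancel_D:
  assumes "Y \<in> blocks E D" "Y' \<in> blocks E D"
  shows "(\<Sum>X\<in>{X\<in>blocks E C. Y \<inter> X \<noteq> {}}. if Y \<inter> X = {} \<or> Y' \<inter> X = {} then 0
      else vec_of (word_step [Edge (Ghost (the_elem (Y \<inter> X))), Edge (Real (the_elem (Y' \<inter> X)))] w))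
    = (if Y = Y' \<and> (\<exists>f\<in>arcs F. head F f = w \<and> \<phi>1 f \<in> Y) then basis_vec w else (0 :: 'w \<Rightarrow>\<^sub>0 'k::field))"
proof -
  have meet: "card (Y \<inter> X) \<le> 1" if "Y \<in> blocks E D" "X \<in> blocks E C" for X Y
    using meet_le_1[OF that(2,1)] by (simp add: Int_commute)
  show ?thesis
    by (rule cancel_blocks[where t = "head F" and h = "tail F" and \<X> = "blocks E D" and \<Y> = "blocks E C"])
      (fact edge_step_Real_iff edge_step_Ghost_iff block_C_disjoint block_D_disjoint D_finite meet
        block_C_cover block_C_lift_unique block_D_lift_unique assms)+
qed

end

section \<open>The action of the Leavitt path algebra\<close>

lemma end_op_carrier_iff:
  "h \<in> acarr (end_op V) \<longleftrightarrow> h \<in> V \<rightarrow>\<^sub>E V \<and> (\<forall>x\<in>V. \<forall>y\<in>V. h (x + y) = h x + h y) \<and>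
    (\<forall>k. \<forall>x\<in>V. h (pm_scale k x) = pm_scale k (h x))"
  by (simp add: end_op_def)

lemma Vsp_closed:
  "0 \<in> Vsp F"
  "x \<in> Vsp F \<Longrightarrow> y \<in> Vsp F \<Longrightarrow> x + y \<in> Vsp F"
  "x \<in> Vsp F \<Longrightarrow> pm_scale k x \<in> Vsp F"
  "x \<in> Vsp F \<Longrightarrow> - x \<in> Vsp F"
  using keys_add[of x y] keys_pm_scale[of k x] by (auto simp: Vsp_def)

lemma basis_vec_in_Vsp [simp]: "basis_vec w \<in> (Vsp F :: ('w \<Rightarrow>\<^sub>0 'k::field) set) \<longleftrightarrow> w \<in> verts F"
  by (simp add: Vsp_def basis_vec_def)

lemma nonassoc_algebra_end_op:
  "nonassoc_algebra (end_op (Vsp F) :: ('k::field, ('w \<Rightarrow>\<^sub>0 'k) \<Rightarrow> _) nalg)" (is "nonassoc_algebra ?B")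
proof
  note [simp] = Vsp_closed end_op_carrier_iff
  have [simp]: "g x \<in> Vsp F" if "g \<in> Vsp F \<rightarrow>\<^sub>E Vsp F" "x \<in> Vsp F"
    for g :: "('w \<Rightarrow>\<^sub>0 'k) \<Rightarrow> 'w \<Rightarrow>\<^sub>0 'k" and x
    using that by (rule PiE_mem)
  have op: "aadd ?B g h = (\<lambda>x\<in>Vsp F. g x + h x)" "amult ?B g h = (\<lambda>x\<in>Vsp F. h (g x))"
    "azero ?B = (\<lambda>x\<in>Vsp F. 0)" "ascale ?B k h = (\<lambda>x\<in>Vsp F. pm_scale k (h x))" for g h k
    by (simp_all add: end_op_def)
  note [simp] = op
  show "azero ?B \<in> acarr ?B" by auto
  show "aadd ?B x y \<in> acarr ?B" if "x \<in> acarr ?B" "y \<in> acarr ?B" for x y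
    using that by (auto simp: pm_scale_add)
  show "amult ?B x y \<in> acarr ?B" if "x \<in> acarr ?B" "y \<in> acarr ?B" for x y
    using that by auto
  show "ascale ?B k x \<in> acarr ?B" if "x \<in> acarr ?B" for x k
    using that by (auto simp: pm_scale_add mult.commute)
  show "aadd ?B (aadd ?B x y) z = aadd ?B x (aadd ?B y z)" for x y z
    by (auto simp: add_ac)
  show "aadd ?B x y = aadd ?B y x" for x y
    by (auto simp: add_ac)
  show "aadd ?B x (azero ?B) = x" if "x \<in> acarr ?B" for x
    using that by (auto simp: PiE_def extensional_def)
  show "aadd ?B x (ascale ?B (- 1) x) = azero ?B" for x
    by auto
  show "amult ?B x (aadd ?B y z) = aadd ?B (amult ?B x y) (amult ?B x z)"
    if "x \<in> acarr ?B" "y \<in> acarr ?B" "z \<in> acarr ?B" for x y z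
    using that by (auto intro!: restrict_ext)
  show "amult ?B (aadd ?B x y) z = aadd ?B (amult ?B x z) (amult ?B y z)"
    if "x \<in> acarr ?B" "y \<in> acarr ?B" "z \<in> acarr ?B" for x y z
    using that by (auto intro!: restrict_ext)
  show "ascale ?B k (aadd ?B x y) = aadd ?B (ascale ?B k x) (ascale ?B k y)" for x y k
    by (auto simp: pm_scale_add)
qed

context rep_graph
begin

abbreviation "gensE \<equiv> gens (double_graph E)"

definition word_act :: "('v, 'e dedge) gen list \<Rightarrow> ('w \<Rightarrow>\<^sub>0 'k::field) \<Rightarrow> 'w \<Rightarrow>\<^sub>0 'k" where
  "word_act l = lin (\<lambda>w. vec_of (word_step l w))"

text \<open>
  The image of \<open>x\<close> under the linear combination \<open>p\<close> of words: the right action of the free algebra that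
  will turn out to factor through the Leavitt path algebra.
\<close>

definition free_act :: "(('v, 'e dedge) gen list \<Rightarrow>\<^sub>0 'k::field) \<Rightarrow> ('w \<Rightarrow>\<^sub>0 'k) \<Rightarrow> 'w \<Rightarrow>\<^sub>0 'k" where
  "free_act p x = lin (\<lambda>l. word_act l x) p"

lemma word_act_basis [simp]: "word_act l (basis_vec w) = vec_of (word_step l w)"
  by (simp add: word_act_def basis_vec_def)

lemma word_act_append: "word_act (l @ m) (x :: 'w \<Rightarrow>\<^sub>0 'k::field) = word_act m (word_act l x)"
proof -
  have "vec_of (word_step (l @ m) w) = word_act m (vec_of (word_step l w) :: 'w \<Rightarrow>\<^sub>0 'k)" for w
    by (cases "word_step l w") (simp_all add: word_step_append, simp add: word_act_def)
  then show ?thesis by (simp add: word_act_def lin_lin)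
qed

lemma keys_vec_of_word_step:
  assumes "w \<in> verts F"
  shows "Poly_Mapping.keys (vec_of (word_step l w)) \<subseteq> verts F"
proof (cases "word_step l w")
  case (Some w')
  with word_step_verts[OF this assms] show ?thesis by (simp add: basis_vec_def)
qed simp

lemma word_act_Vsp: "x \<in> Vsp F \<Longrightarrow> word_act l x \<in> Vsp F"
  unfolding word_act_def Vsp_def mem_Collect_eq
  by (rule keys_lin, rule keys_vec_of_word_step) blast

lemma free_act_Vsp: "x \<in> Vsp F \<Longrightarrow> free_act p x \<in> Vsp F"
  using word_act_Vsp[of x] unfolding free_act_def Vsp_def mem_Collect_eq
  by (intro keys_lin)

lemma free_act_word [simp]: "free_act (word l) x = word_act l x"
  by (simp add: free_act_def word_def)

text \<open>
  Multiplication in \<open>end_op\<close> is composition in the opposite order, matching right actions: the left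
  factor acts first.
\<close>

lemma free_act_mult: "free_act (word_mult p q) x = free_act q (free_act p x)"
proof -
  have 1: "word_act b (lin (\<lambda>a. word_act a x) p) = lin (\<lambda>a. word_act (a @ b) x) p" for b
    unfolding word_act_append unfolding word_act_def[of b] by (rule lin_lin)
  have "free_act (word_mult p q) x = lin (\<lambda>a. lin (\<lambda>b. word_act (a @ b) x) q) p"
    unfolding free_act_def word_mult_lin lin_lin by (simp add: word_def)
  also have "\<dots> = free_act q (free_act p x)"
    unfolding free_act_def 1 by (rule lin_swap)
  finally show ?thesis .
qed

lemma free_act_hom: "(\<lambda>p. \<lambda>x\<in>Vsp F. free_act p x) \<in> alg_hom (free_alg S) (end_op (Vsp F))"
  unfolding alg_hom_def mem_Collect_eq end_op_carrier_iff
  by (auto simp: free_alg_def end_op_def Vsp_closed free_act_Vsp free_act_mult intro!: restrict_ext)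
    (simp_all add: free_act_def word_act_def lin_add lin_scale lin_add_fun lin_scale_fun)

lemma free_act_eq_0_if:
  assumes zero: "\<And>w. w \<in> verts F \<Longrightarrow> lin (\<lambda>l. vec_of (word_step l w)) p = (0 :: 'w \<Rightarrow>\<^sub>0 'k::field)"
    and x: "x \<in> Vsp F"
  shows "free_act p x = 0"
proof -
  have "free_act p x = lin (\<lambda>w. lin (\<lambda>l. vec_of (word_step l w)) p) x"
    unfolding free_act_def word_act_def by (rule lin_swap)
  also have "\<dots> = lin (\<lambda>w. 0) x"
    by (intro lin_cong zero) (use x in \<open>auto simp: Vsp_def\<close>)
  also have "\<dots> = 0" by (simp add: lin_def)
  finally show ?thesis .
qed

lemma lin_word [simp]: "lin b (word l) = b l"
  by (simp add: word_def)

lemma edge_step_if_arc: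
  assumes "edge_step d w = Some w'"
  shows "\<phi>0 w = tail (double_graph E) d" "\<phi>0 w' = head (double_graph E) d"
  using edge_step_double_graph[OF assms] by simp_all

lemma path_rels_act:
  assumes p: "p \<in> path_rels (double_graph E)" and x: "x \<in> Vsp F"
  shows "free_act p (x :: 'w \<Rightarrow>\<^sub>0 'k::field) = 0"
proof (rule free_act_eq_0_if[OF _ x])
  fix w
  have vert: "vec_of (word_step [Vert (tail (double_graph E) d), Edge d] w) = (vec_of (word_step [Edge d] w) :: _ \<Rightarrow>\<^sub>0 'k)"
    "vec_of (word_step [Edge d, Vert (head (double_graph E) d)] w) = (vec_of (word_step [Edge d] w) :: _ \<Rightarrow>\<^sub>0 'k)" for d
    using edge_step_if_arc[of d w] by (cases "edge_step d w"; simp)+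
  from p consider
      (vv) u v where "p = word [Vert u, Vert v] - (if u = v then word [Vert u] else 0)"
    | (tail) d where "p = word [Vert (tail (double_graph E) d), Edge d] - word [Edge d]"
    | (head) d where "p = word [Edge d, Vert (head (double_graph E) d)] - word [Edge d]"
    unfolding path_rels_def by blast
  then show "lin (\<lambda>l. vec_of (word_step l w)) p = (0 :: 'w \<Rightarrow>\<^sub>0 'k)"
  proof cases
    case vv then show ?thesis by (simp add: lin_diff)
  next
    case tail
    then show ?thesis using vert(1)[of d] by (simp add: lin_diff del: word_step.simps)
  next
    case head
    then show ?thesis using vert(2)[of d] by (simp add: lin_diff del: word_step.simps)
  qed
qed

lemma lin_meet2:
  "lin g (meet2 a b X Y X' Y') = (if X \<inter> Y = {} \<or> X' \<inter> Y' = {} then 0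
    else g [Edge (a (the_elem (X \<inter> Y))), Edge (b (the_elem (X' \<inter> Y')))])"
  by (simp add: meet2_def)

lemma leavitt_rels_act:
  assumes p: "p \<in> leavitt_rels E C D" and x: "x \<in> Vsp F"
  shows "free_act p (x :: 'w \<Rightarrow>\<^sub>0 'k::field) = 0"
proof (rule free_act_eq_0_if[OF _ x])
  fix w assume w: "w \<in> verts F"
  have vert: "lin (\<lambda>l. vec_of (word_step l w)) (if P then word [Vert v] else 0) =
      (if P \<and> \<phi>0 w = v then basis_vec w else (0 :: _ \<Rightarrow>\<^sub>0 'k))" for P v
    by simp
  from p consider
      (L1) X X' where "X \<in> blocks E C" "X' \<in> blocks E C"
        "p = (\<Sum>Y\<in>{Y \<in> blocks E D. X \<inter> Y \<noteq> {}}. meet2 Real Ghost X Y X' Y)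
          - (if X = X' then word [Vert (the_elem (tail E ` X))] else 0)"
    | (L2) Y Y' where "Y \<in> blocks E D" "Y' \<in> blocks E D"
        "p = (\<Sum>X\<in>{X \<in> blocks E C. X \<inter> Y \<noteq> {}}. meet2 Ghost Real X Y X Y')
          - (if Y = Y' then word [Vert (the_elem (head E ` Y))] else 0)"
    unfolding leavitt_rels_def by blast
  then show "lin (\<lambda>l. vec_of (word_step l w)) p = (0 :: 'w \<Rightarrow>\<^sub>0 'k)"
  proof cases
    case L1
    show ?thesis
      unfolding L1(3) lin_diff lin_sum lin_meet2 vert cancel_C[OF L1(1,2)]
        block_C_lift_iff[OF L1(1) w] by (rule diff_self)
  next
    case L2
    show ?thesis
      unfolding L2(3) lin_diff lin_sum lin_meet2 vert Int_commute[of _ Y] Int_commute[of _ Y']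
        cancel_D[OF L2(1,2)] block_D_lift_iff[OF L2(1) w] by (rule diff_self)
  qed
qed

lemma free_alg_diff:
  assumes "p \<in> acarr (free_alg S)" "q \<in> acarr (free_alg S)" shows "p - q \<in> acarr (free_alg S)"
  using assms keys_diff[of p q] unfolding free_alg_def by fastforce

lemma free_alg_sum: "(\<And>i. i \<in> I \<Longrightarrow> f i \<in> acarr (free_alg S)) \<Longrightarrow> sum f I \<in> acarr (free_alg S)"
  using keys_sum[of f I] unfolding free_alg_def by fastforce

lemma path_rels_carrier: "path_rels (double_graph E) \<subseteq> acarr (free_alg gensE)"
proof -
  interpret dE: wf_digraph "double_graph E"
    by (rule wf_digraph_double_graph) unfold_locales
  have zero: "0 \<in> acarr (free_alg S)" for S :: "('v, 'e dedge) gen set" by (simp add: free_alg_def)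
  have vert: "Vert v \<in> gensE" if "v \<in> verts (double_graph E)" for v using that by (simp add: gens_def)
  have edge: "Edge d \<in> gensE" if "d \<in> arcs (double_graph E)" for d using that by (simp add: gens_def)
  show ?thesis
    unfolding path_rels_def
    by (auto intro!: free_alg_diff zero simp: word_in_free_alg vert edge simp del: verts_double_graph)
qed

lemma the_elem_meet:
  assumes "X \<in> blocks E C" "Y \<in> blocks E D" "X \<inter> Y \<noteq> {}"
  shows "the_elem (X \<inter> Y) \<in> arcs E"
proof -
  from assms obtain e where e: "e \<in> X \<inter> Y" by blast
  have "finite (X \<inter> Y)" "card (X \<inter> Y) \<le> Suc 0" using assms C_finite meet_le_1 by simp_all
  then have "X \<inter> Y = {e}" using e card_le_Suc0_iff_eq[of "X \<inter> Y"] by blast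
  with e block_C(1)[OF assms(1)] show ?thesis by auto
qed

lemma leavitt_rels_carrier: "leavitt_rels E C D \<subseteq> acarr (free_alg gensE)"
proof -
  have zero: "0 \<in> acarr (free_alg S)" for S :: "('v, 'e dedge) gen set" by (simp add: free_alg_def)
  have vert: "Vert v \<in> gensE" if "v \<in> verts E" for v using that by (simp add: gens_def)
  have edge: "Edge (Real e) \<in> gensE" "Edge (Ghost e) \<in> gensE" if "e \<in> arcs E" for e
    using that by (simp_all add: gens_def double_graph_def)
  have meet: "meet2 Real Ghost X Y X' Y' \<in> acarr (free_alg gensE)"
    "meet2 Ghost Real X Y X' Y' \<in> acarr (free_alg gensE)"
    if "X \<in> blocks E C" "X' \<in> blocks E C" "Y \<in> blocks E D" "Y' \<in> blocks E D" for X X' Y Y'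
    using that by (simp_all add: meet2_def zero word_in_free_alg edge the_elem_meet)
  have "the_elem (tail E ` X) \<in> verts E" if "X \<in> blocks E C" for X using block_C(2)[OF that] by metis
  moreover have "the_elem (head E ` Y) \<in> verts E" if "Y \<in> blocks E D" for Y using block_D(2)[OF that] by metis
  ultimately show ?thesis
    unfolding leavitt_rels_def
    by (auto intro!: free_alg_diff free_alg_sum meet zero simp: word_in_free_alg vert)
qed

abbreviation "LA \<equiv> leavitt_alg E C D"

definition class_of :: "(('v, 'e dedge) gen list \<Rightarrow>\<^sub>0 'k::field) \<Rightarrow> ('v, 'e, 'k) lpa" where
  "class_of p = coset (path_alg (double_graph E)) (leavitt_ideal E C D) (to_path_alg (double_graph E) p)"

lemma lpa_gen_eq_class_of: "lpa_gen E C D g = class_of (word [g])"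
  by (simp add: lpa_gen_def class_of_def)

lemma nonassoc_algebra_path_alg: "nonassoc_algebra (path_alg (double_graph E))"
  and to_path_alg_hom: "to_path_alg (double_graph E) \<in> alg_hom (free_alg gensE) (path_alg (double_graph E))"
  and to_path_alg_surj: "acarr (path_alg (double_graph E)) = to_path_alg (double_graph E) ` acarr (free_alg gensE)"
proof -
  interpret A: nonassoc_algebra "free_alg gensE" by (rule nonassoc_algebra_free_alg)
  have I: "alg_ideal (free_alg gensE) (path_ideal (double_graph E))"
    unfolding path_ideal_def by (rule A.alg_ideal_ideal_gen[OF path_rels_carrier])
  show "nonassoc_algebra (path_alg (double_graph E))"
    unfolding path_alg_def by (rule A.nonassoc_algebra_quot[OF I])
  show "to_path_alg (double_graph E) \<in> alg_hom (free_alg gensE) (path_alg (double_graph E))"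
    unfolding path_alg_def to_path_alg_def by (rule A.coset_quot[OF I])
  show "acarr (path_alg (double_graph E)) = to_path_alg (double_graph E) ` acarr (free_alg gensE)"
    by (simp add: path_alg_def to_path_alg_def quot_alg_def)
qed

lemma leavitt_rels_path_alg:
  "to_path_alg (double_graph E) ` leavitt_rels E C D \<subseteq> acarr (path_alg (double_graph E))"
  unfolding to_path_alg_surj using leavitt_rels_carrier by (rule image_mono)

text \<open>
  The Leavitt path algebra is a quotient of a quotient; \<open>class_of\<close> composes the two projections. As it
  is onto, every statement about elements of the algebra can be reduced to the free algebra.
\<close>

lemma class_of_hom: "class_of \<in> alg_hom (free_alg gensE) (LA :: ('k::field, ('v, 'e, 'k) lpa) nalg)"
  and class_of_surj: "acarr (LA :: ('k, ('v, 'e, 'k) lpa) nalg) = class_of ` acarr (free_alg gensE)"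
proof -
  let ?P = "path_alg (double_graph E) :: ('k, _) nalg"
  interpret P: nonassoc_algebra ?P by (rule nonassoc_algebra_path_alg)
  have "coset ?P (leavitt_ideal E C D) \<in> alg_hom ?P LA"
    unfolding leavitt_alg_def leavitt_ideal_def
    by (rule P.coset_quot[OF P.alg_ideal_ideal_gen[OF leavitt_rels_path_alg]])
  from alg_hom_comp[OF to_path_alg_hom this]
  show "class_of \<in> alg_hom (free_alg gensE) (LA :: ('k, ('v, 'e, 'k) lpa) nalg)"
    unfolding class_of_def[abs_def] .
  show "acarr (LA :: ('k, ('v, 'e, 'k) lpa) nalg) = class_of ` acarr (free_alg gensE)"
    by (simp add: leavitt_alg_def quot_alg_def to_path_alg_surj class_of_def[abs_def] image_image)
qed

text \<open>
  Both quotients are taken by ideals generated by elements that act as zero.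
\<close>

lemma ex_action:
  "\<exists>\<pi>\<in>alg_hom LA (end_op (Vsp F)). \<forall>p\<in>acarr (free_alg gensE).
    \<pi> (class_of p) = (\<lambda>x\<in>Vsp F. free_act p (x :: 'w \<Rightarrow>\<^sub>0 'k::field))"
proof -
  let ?B = "end_op (Vsp F) :: ('k, ('w \<Rightarrow>\<^sub>0 'k) \<Rightarrow> _) nalg"
  let ?h = "\<lambda>p. \<lambda>x\<in>Vsp F. free_act p (x :: 'w \<Rightarrow>\<^sub>0 'k)"
  have zero: "azero ?B = (\<lambda>x\<in>Vsp F. 0)" by (simp add: end_op_def)
  have zero1: "\<forall>p\<in>path_rels (double_graph E). ?h p = azero ?B"
    unfolding zero using path_rels_act by (intro ballI restrict_ext)
  obtain g where g: "g \<in> alg_hom (path_alg (double_graph E)) ?B"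
    "\<forall>p\<in>acarr (free_alg gensE). g (to_path_alg (double_graph E) p) = ?h p"
    by (rule bexE[OF quot_lift[OF nonassoc_algebra_free_alg nonassoc_algebra_end_op free_act_hom path_rels_carrier zero1,
          folded path_ideal_def, folded path_alg_def to_path_alg_def]])
  have zero2: "\<forall>y\<in>to_path_alg (double_graph E) ` leavitt_rels E C D. g y = azero ?B"
  proof
    fix y :: "(('v, 'e dedge) gen list \<Rightarrow>\<^sub>0 'k) set"
    assume "y \<in> to_path_alg (double_graph E) ` leavitt_rels E C D"
    then obtain p where p: "p \<in> leavitt_rels E C D" "y = to_path_alg (double_graph E) p" by blast
    have "?h p = azero ?B"
      unfolding zero using leavitt_rels_act[OF p(1)] by (intro restrict_ext)
    moreover have "p \<in> acarr (free_alg gensE)" using p(1) leavitt_rels_carrier by blast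
    ultimately show "g y = azero ?B" using p(2) g(2) by simp
  qed
  obtain \<pi> where \<pi>: "\<pi> \<in> alg_hom LA ?B"
    "\<forall>y\<in>acarr (path_alg (double_graph E)).
      \<pi> (coset (path_alg (double_graph E)) (leavitt_ideal E C D) y) = g y"
    by (rule bexE[OF quot_lift[OF nonassoc_algebra_path_alg nonassoc_algebra_end_op g(1) leavitt_rels_path_alg zero2,
          folded leavitt_ideal_def, folded leavitt_alg_def]])
  have "\<pi> (class_of p) = ?h p" if "p \<in> acarr (free_alg gensE)" for p
  proof -
    have "to_path_alg (double_graph E) p \<in> acarr (path_alg (double_graph E))"
      unfolding to_path_alg_surj using that by (rule imageI)
    then show ?thesis unfolding class_of_def using \<pi>(2) g(2) that by simp
  qed
  with \<pi>(1) show ?thesis by (intro bexI[of _ \<pi>] ballI)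
qed

lemma lin_ext_eq_lin: "lin_ext F b = (\<lambda>x\<in>Vsp F. lin b x)"
  by (simp add: lin_ext_def lin_def)

lemma vec_of_if: "vec_of (if b then Some w else None) = (if b then basis_vec w else 0)"
  by simp

lemma word_step_single: "word_step [g] w = gen_step g w"
  by (cases "gen_step g w") simp_all

lemma sigma_eq_free_act:
  "sigma_vert F \<phi>0 v = (\<lambda>x\<in>Vsp F. free_act (word [Vert v]) x)"
  "sigma_real F \<phi>1 e = (\<lambda>x\<in>Vsp F. free_act (word [Edge (Real e)]) x)"
  "sigma_ghost F \<phi>1 e = (\<lambda>x\<in>Vsp F. free_act (word [Edge (Ghost e)]) x)"
  unfolding sigma_vert_def sigma_real_def sigma_ghost_def lin_ext_eq_lin free_act_word word_act_def
    word_step_single gen_step_simps edge_step_def dedge.case vec_of_if by (rule refl)+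

text \<open>
  The homomorphism of \<open>ex_action\<close>, made extensional, satisfies the defining description; any other
  candidate agrees with it on the generators, hence on all classes.
\<close>

lemma rep_hom_class_of:
  assumes p: "p \<in> acarr (free_alg gensE)"
  shows "rep_hom E C D F \<phi>0 \<phi>1 (class_of p) = (\<lambda>x\<in>Vsp F. free_act p (x :: 'w \<Rightarrow>\<^sub>0 'k::field))"
proof -
  let ?B = "end_op (Vsp F) :: ('k, ('w \<Rightarrow>\<^sub>0 'k) \<Rightarrow> _) nalg"
  let ?A = "free_alg gensE :: ('k, _) nalg"
  let ?P = "\<lambda>\<pi>. \<pi> \<in> alg_hom LA ?B \<and> \<pi> \<in> extensional (acarr LA) \<and>
     (\<forall>v\<in>verts E. \<pi> (lpa_gen E C D (Vert v)) = sigma_vert F \<phi>0 v) \<and>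
     (\<forall>e\<in>arcs E. \<pi> (lpa_gen E C D (Edge (Real e))) = sigma_real F \<phi>1 e) \<and>
     (\<forall>e\<in>arcs E. \<pi> (lpa_gen E C D (Edge (Ghost e))) = sigma_ghost F \<phi>1 e)"
  obtain \<pi>0 where \<pi>0: "\<pi>0 \<in> alg_hom LA ?B"
    "\<forall>p\<in>acarr ?A. \<pi>0 (class_of p) = (\<lambda>x\<in>Vsp F. free_act p x)"
    by (rule bexE[OF ex_action])
  define \<pi> where "\<pi> = restrict \<pi>0 (acarr (LA :: ('k, _) nalg))"
  have class_in: "class_of q \<in> acarr LA" if "q \<in> acarr ?A" for q
    using that class_of_surj by blast
  have \<pi>: "\<pi> (class_of q) = (\<lambda>x\<in>Vsp F. free_act q x)" if "q \<in> acarr ?A" for q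
    using \<pi>0(2)[rule_format, OF that] class_in[OF that] by (simp add: \<pi>_def)
  have gen: "word [g] \<in> acarr ?A" if "g \<in> gensE" for g
    using that by (simp add: word_in_free_alg)
  have gens_cases: "(\<exists>v\<in>verts E. g = Vert v) \<or> (\<exists>e\<in>arcs E. g = Edge (Real e)) \<or> (\<exists>e\<in>arcs E. g = Edge (Ghost e))"
    if "g \<in> gensE" for g
    using that unfolding gens_def double_graph_def by auto
  have gens_in: "v \<in> verts E \<Longrightarrow> Vert v \<in> gensE" "e \<in> arcs E \<Longrightarrow> Edge (Real e) \<in> gensE"
    "e \<in> arcs E \<Longrightarrow> Edge (Ghost e) \<in> gensE" for v e
    by (simp_all add: gens_def double_graph_def)
  interpret P: nonassoc_algebra "path_alg (double_graph E) :: ('k, _) nalg" by (rule nonassoc_algebra_path_alg)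
  interpret L: nonassoc_algebra "LA :: ('k, _) nalg"
    unfolding leavitt_alg_def leavitt_ideal_def
    by (rule P.nonassoc_algebra_quot[OF P.alg_ideal_ideal_gen[OF leavitt_rels_path_alg]])
  have "\<pi> \<in> alg_hom LA ?B"
    using \<pi>0(1) by (simp add: alg_hom_def \<pi>_def)
  then have P\<pi>: "?P \<pi>"
    unfolding lpa_gen_eq_class_of using \<pi>[OF gen[OF gens_in(1)]] \<pi>[OF gen[OF gens_in(2)]] \<pi>[OF gen[OF gens_in(3)]]
    by (simp only: sigma_eq_free_act) (simp add: \<pi>_def)
  have "\<psi> = \<pi>" if \<psi>: "?P \<psi>" for \<psi>
  proof (rule extensionalityI[of _ "acarr (LA :: ('k, _) nalg)"])
    show "\<psi> \<in> extensional (acarr LA)" "\<pi> \<in> extensional (acarr LA)" using \<psi> P\<pi> by blast+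
    fix a assume "a \<in> acarr (LA :: ('k, _) nalg)"
    then obtain q where q: "q \<in> acarr ?A" "a = class_of q" using class_of_surj by blast
    have hom: "(\<lambda>q. \<rho> (class_of q)) \<in> alg_hom ?A ?B" if "\<rho> \<in> alg_hom LA ?B" for \<rho>
      by (rule alg_hom_comp[OF class_of_hom that])
    have "\<psi> (class_of q) = \<pi> (class_of q)"
    proof (rule free_alg_hom_eqI[OF nonassoc_algebra_end_op hom hom _ q(1)])
      show "\<psi> \<in> alg_hom LA ?B" "\<pi> \<in> alg_hom LA ?B" using \<psi> P\<pi> by blast+
      fix g assume "g \<in> gensE"
      then show "\<psi> (class_of (word [g])) = \<pi> (class_of (word [g]))"
        using gens_cases[of g] \<psi> P\<pi> unfolding lpa_gen_eq_class_of by metis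
    qed
    with q show "\<psi> a = \<pi> a" by simp
  qed
  with P\<pi> have "rep_hom E C D F \<phi>0 \<phi>1 = \<pi>"
    unfolding rep_hom_def by (rule the_equality)
  with \<pi>[OF p] show ?thesis by simp
qed

lemma rep_act_class_of:
  "p \<in> acarr (free_alg gensE) \<Longrightarrow> x \<in> Vsp F \<Longrightarrow> rep_act E C D F \<phi>0 \<phi>1 x (class_of p) = free_act p x"
  by (simp add: rep_act_def rep_hom_class_of)

end

section \<open>Simplicity and irreducibility\<close>

context rep_graph
begin

abbreviation "act \<equiv> rep_act E C D F \<phi>0 \<phi>1"

lemma class_of_mult:
  "p \<in> acarr (free_alg gensE) \<Longrightarrow> q \<in> acarr (free_alg gensE) \<Longrightarrow>
    amult LA (class_of p) (class_of q) = class_of (amult (free_alg gensE) p q)"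
  and class_of_scale:
  "p \<in> acarr (free_alg gensE) \<Longrightarrow> ascale LA k (class_of p) = class_of (ascale (free_alg gensE) k p)"
  by (rule sym, simp add: class_of_hom[unfolded alg_hom_def mem_Collect_eq])+

lemma edge_in_gens: "d \<in> arcs (double_graph E) \<Longrightarrow> Edge d \<in> gensE"
  by (simp add: gens_def)

lemma vert_in_gens: "v \<in> verts E \<Longrightarrow> Vert v \<in> gensE"
  by (simp add: gens_def)

lemma foldl_class_of:
  assumes "l \<noteq> []" "set l \<subseteq> gensE" "set xs \<subseteq> arcs (double_graph E)"
  shows "foldl (amult LA) (class_of (word l)) (map (\<lambda>y. lpa_gen E C D (Edge y)) xs) =
    (class_of (word (l @ map Edge xs)) :: ('v, 'e, 'k::field) lpa)"
  using assms
proof (induction xs arbitrary: l)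
  case (Cons x xs)
  have "word l \<in> acarr (free_alg gensE :: ('k, _) nalg)"
    "word [Edge x] \<in> acarr (free_alg gensE :: ('k, _) nalg)"
    using Cons.prems by (simp_all add: word_in_free_alg edge_in_gens)
  then have "amult LA (class_of (word l)) (class_of (word [Edge x])) =
      (class_of (amult (free_alg gensE) (word l) (word [Edge x])) :: ('v, 'e, 'k) lpa)"
    by (rule class_of_mult)
  also have "\<dots> = class_of (word (l @ [Edge x]))"
    by (simp add: free_alg_def word_mult_word)
  finally show ?case
    using Cons.IH[of "l @ [Edge x]"] Cons.prems by (simp add: lpa_gen_eq_class_of edge_in_gens)
qed simp

lemma walk_arcs:
  assumes "(a, q) \<in> Walk E"
  shows "a \<in> verts E" "set q \<subseteq> arcs (double_graph E)" "q \<noteq> [] \<Longrightarrow> tail (double_graph E) (hd q) = a"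
proof -
  interpret dE: wf_digraph "double_graph E"
    by (rule wf_digraph_double_graph) unfold_locales
  obtain v where "dE.awalk a q v" using assms by (auto simp: Walk_def)
  then show "a \<in> verts E" "set q \<subseteq> arcs (double_graph E)" "q \<noteq> [] \<Longrightarrow> tail (double_graph E) (hd q) = a"
    by (cases q; auto simp: dE.awalk_def)+
qed

text \<open>
  A nontrivial walk is represented by the product of its edges, without its start vertex. Prefixing the
  start vertex does not change the action, since the first edge lifts only to arcs starting over that
  vertex; so trivial and nontrivial walks get the same description.
\<close>

lemma ex_lpa_walk_word:
  assumes "(a, q) \<in> Walk E"
  shows "\<exists>l. word l \<in> acarr (free_alg gensE :: ('k::field, _) nalg) \<and>
    lpa_walk E C D (a, q) = (class_of (word l) :: ('v, 'e, 'k) lpa) \<and>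
    word_step l = word_step (Vert a # map Edge q)"
proof (cases q)
  case Nil
  then show ?thesis
    using walk_arcs(1)[OF assms]
    by (intro exI[of _ "[Vert a]"]) (simp add: word_in_free_alg vert_in_gens lpa_gen_eq_class_of)
next
  case (Cons d r)
  have *: "set (d # r) \<subseteq> arcs (double_graph E)" using walk_arcs(2)[OF assms] Cons by simp
  have "word_step (map Edge q) w = word_step (Vert a # map Edge q) w" for w
  proof (cases "edge_step d w")
    case (Some w')
    then have "\<phi>0 w = a" using edge_step_if_arc(1)[OF Some] walk_arcs(3)[OF assms] Cons by simp
    then show ?thesis by simp
  qed (simp add: Cons)
  then have "word_step (map Edge q) = word_step (Vert a # map Edge q)" ..
  moreover have "word (map Edge q) \<in> acarr (free_alg gensE :: ('k, _) nalg)"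
    using * Cons by (auto simp: word_in_free_alg edge_in_gens)
  moreover have "lpa_walk E C D (a, q) = (class_of (word (map Edge q)) :: ('v, 'e, 'k) lpa)"
    using foldl_class_of[of "[Edge d]" r] * Cons by (simp add: lpa_gen_eq_class_of edge_in_gens)
  ultimately show ?thesis by blast
qed

lemma act_walk:
  assumes walk: "(a, q) \<in> Walk E"
  shows "x \<in> Vsp F \<Longrightarrow> act x (ascale LA k (lpa_walk E C D (a, q))) =
      pm_scale (k :: 'k::field) (word_act (Vert a # map Edge q) x)"
    and "ascale LA k (lpa_walk E C D (a, q)) \<in> acarr (LA :: ('k, ('v, 'e, 'k) lpa) nalg)"
proof -
  let ?A = "free_alg gensE :: ('k, _) nalg"
  interpret A: nonassoc_algebra ?A by (rule nonassoc_algebra_free_alg)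
  obtain l where l: "word l \<in> acarr ?A" "lpa_walk E C D (a, q) = (class_of (word l) :: ('v, 'e, 'k) lpa)"
    "word_step l = word_step (Vert a # map Edge q)"
    using ex_lpa_walk_word[OF walk] by blast
  have in_A: "ascale ?A k (word l) \<in> acarr ?A" using l(1) by (rule A.scale_closed)
  have eq: "ascale LA k (lpa_walk E C D (a, q)) = (class_of (ascale ?A k (word l)) :: ('v, 'e, 'k) lpa)"
    unfolding l(2) by (rule class_of_scale[OF l(1)])
  show "ascale LA k (lpa_walk E C D (a, q)) \<in> acarr (LA :: ('k, ('v, 'e, 'k) lpa) nalg)"
    unfolding eq class_of_surj using in_A by (rule imageI)
  assume x: "x \<in> Vsp F"
  have "act x (ascale LA k (lpa_walk E C D (a, q))) = free_act (ascale ?A k (word l)) x"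
    unfolding eq by (rule rep_act_class_of[OF in_A x])
  also have "\<dots> = pm_scale k (word_act l x)"
    by (simp add: free_alg_def free_act_def lin_scale)
  finally show "act x (ascale LA k (lpa_walk E C D (a, q))) =
      pm_scale k (word_act (Vert a # map Edge q) x)"
    unfolding word_act_def l(3) .
qed

lemma act_cases:
  assumes x: "x \<in> Vsp F" and a: "a \<in> acarr (LA :: ('k::field, ('v, 'e, 'k) lpa) nalg)"
  shows "\<exists>p\<in>acarr (free_alg gensE). act x a = free_act p x"
proof -
  from a obtain p where p: "p \<in> acarr (free_alg gensE)" "a = class_of p"
    unfolding class_of_surj by (rule imageE)
  then have "act x a = free_act p x" using rep_act_class_of[OF p(1) x] by simp
  with p(1) show ?thesis by (rule bexI[rotated])
qed

lemma basis_vec_neq_0 [simp]: "basis_vec w \<noteq> (0 :: 'b \<Rightarrow>\<^sub>0 'k::field)"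
  by (metis basis_vec_def lookup_single_eq lookup_zero zero_neq_one)

lemma basis_vec_if_irreducible:
  assumes irr: "irreducible_rep F \<phi>0 \<phi>1" and x: "x \<in> Vsp F - {0 :: 'w \<Rightarrow>\<^sub>0 'k::field}"
  shows "\<exists>k. \<exists>p\<in>Walk E. act x (ascale LA k (lpa_walk E C D p)) \<in> basis_vec ` verts F"
proof -
  let ?S = "Poly_Mapping.keys x"
  have S: "finite ?S" "?S \<noteq> {}" "?S \<subseteq> verts F" using x by (auto simp: Vsp_def)
  obtain s q where s: "{s'\<in>?S. word_step (Vert (\<phi>0 s) # map Edge q) s' \<noteq> None} = {s}"
    by (rule isolate_vertex[OF irr S])
  let ?l = "Vert (\<phi>0 s) # map Edge q"
  have "s \<in> ?S" "word_step ?l s \<noteq> None" using s by blast+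
  then obtain t where t: "word_step (map Edge q) s = Some t" "word_step ?l s = Some t" by auto
  have sF: "s \<in> verts F" using \<open>s \<in> ?S\<close> S(3) by blast
  from awalk_if_word_step[OF t(1) sF] have walk: "(\<phi>0 s, q) \<in> Walk E"
    by (auto simp: Walk_def)
  have "word_act ?l x = (\<Sum>w\<in>{s}. pm_scale (Poly_Mapping.lookup x w) (vec_of (word_step ?l w)))"
    unfolding word_act_def lin_def
  proof (rule sum.mono_neutral_right)
    show "\<forall>w\<in>?S - {s}. pm_scale (Poly_Mapping.lookup x w) (vec_of (word_step ?l w)) = 0"
    proof
      fix w assume "w \<in> ?S - {s}"
      then have "word_step ?l w = None" using s by blast
      then show "pm_scale (Poly_Mapping.lookup x w) (vec_of (word_step ?l w)) = 0"
        by (simp del: word_step.simps)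
    qed
  qed (use \<open>s \<in> ?S\<close> in auto)
  also have "\<dots> = pm_scale (Poly_Mapping.lookup x s) (basis_vec t)"
    using t(2) by (simp del: word_step.simps)
  finally have "act x (ascale LA (inverse (Poly_Mapping.lookup x s)) (lpa_walk E C D (\<phi>0 s, q))) = basis_vec t"
    using act_walk(1)[OF walk, of x] x \<open>s \<in> ?S\<close> by (simp add: in_keys_iff)
  moreover have "t \<in> verts F" using word_step_verts[OF t(1) sF] .
  ultimately show ?thesis using walk by (metis imageI)
qed

text \<open>
  If \<open>u\<close> and \<open>v\<close> violate irreducibility, the coefficient sum vanishes on the orbit of their difference
  but not on basis vectors.
\<close>

lemma irreducible_if_basis_vec:
  assumes "\<forall>x\<in>Vsp F - {0 :: 'w \<Rightarrow>\<^sub>0 'k::field}. \<exists>a\<in>acarr LA. act x a \<in> basis_vec ` verts F"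
  shows "irreducible_rep F \<phi>0 \<phi>1"
proof (rule ccontr)
  assume "\<not> irreducible_rep F \<phi>0 \<phi>1"
  then obtain u v where uv: "u \<in> verts F" "v \<in> verts F" "u \<noteq> v"
    "walk_map \<phi>0 \<phi>1 ` Walk_from F u = walk_map \<phi>0 \<phi>1 ` Walk_from F v"
    unfolding irreducible_rep_def by blast
  define x :: "'w \<Rightarrow>\<^sub>0 'k" where "x = basis_vec u - basis_vec v"
  \<comment> \<open>the coefficient sum, with values in the one-dimensional space over \<open>unit\<close> so that it is a linear extension\<close>
  define \<epsilon> :: "('w \<Rightarrow>\<^sub>0 'k) \<Rightarrow> (unit \<Rightarrow>\<^sub>0 'k)" where "\<epsilon> = lin (\<lambda>_. basis_vec ())"
  have \<epsilon>_basis: "\<epsilon> (basis_vec w) = basis_vec ()" for w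
    by (simp add: \<epsilon>_def basis_vec_def)
  have "Poly_Mapping.lookup x u \<noteq> 0"
    using uv(3) by (simp add: x_def basis_vec_def lookup_minus lookup_single)
  then have "x \<noteq> 0" by auto
  moreover have "x \<in> Vsp F"
    using Vsp_closed(2)[of "basis_vec u" F "- basis_vec v"] Vsp_closed(4)[of "basis_vec v" F] uv(1,2)
    by (simp add: x_def)
  ultimately obtain a w where a: "a \<in> acarr LA" "act x a = basis_vec w" using assms by blast
  obtain p where "act x a = free_act p x"
    by (rule bexE[OF act_cases[OF \<open>x \<in> Vsp F\<close> a(1)]])
  with a(2) have "free_act p x = basis_vec w" by simp
  then have "basis_vec () = \<epsilon> (free_act p x)" by (simp add: \<epsilon>_basis)
  also have "\<dots> = lin (\<lambda>l. \<epsilon> (word_act l x)) p"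
    unfolding free_act_def \<epsilon>_def by (rule lin_lin)
  also have "\<dots> = lin (\<lambda>l. 0) p"
  proof (rule lin_cong)
    fix l
    have "\<epsilon> (word_act l x) = \<epsilon> (vec_of (word_step l u)) - \<epsilon> (vec_of (word_step l v))"
      unfolding x_def word_act_def \<epsilon>_def by (simp add: basis_vec_def lin_diff)
    also have "\<dots> = 0"
      using word_step_equiv[OF uv(1,2,4), of l]
      by (cases "word_step l u"; cases "word_step l v") (simp_all add: \<epsilon>_basis)
    finally show "\<epsilon> (word_act l x) = 0" .
  qed
  finally show False by (simp add: lin_def)
qed

text \<open>
  The orbit of \<open>x\<close> is a nonzero submodule, hence everything.
\<close>

lemma basis_vec_if_simple:
  assumes simple: "simple_right_module LA (Vsp F :: ('w \<Rightarrow>\<^sub>0 'k) set) act"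
    and x: "x \<in> Vsp F - {0 :: 'w \<Rightarrow>\<^sub>0 'k::field}"
  shows "\<exists>a\<in>acarr LA. act x a \<in> basis_vec ` verts F"
proof -
  let ?A = "free_alg gensE :: ('k, _) nalg"
  interpret A: nonassoc_algebra ?A by (rule nonassoc_algebra_free_alg)
  have xV: "x \<in> Vsp F" using x by simp
  define U where "U = (\<lambda>p. free_act p x) ` acarr ?A"
  have add: "free_act (aadd ?A p q) x = free_act p x + free_act q x" for p q
    by (simp add: free_alg_def free_act_def lin_add)
  have scale: "free_act (ascale ?A k p) x = pm_scale k (free_act p x)" for k p
    by (simp add: free_alg_def free_act_def lin_scale)
  have mult: "free_act (amult ?A p q) x = free_act q (free_act p x)" for p q
    by (simp add: free_alg_def free_act_mult)
  have zero: "free_act (azero ?A) x = 0"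
    by (simp add: free_alg_def free_act_def)
  have "right_submodule LA (Vsp F) act U"
    unfolding right_submodule_def
  proof (intro conjI ballI)
    show "U \<subseteq> Vsp F" unfolding U_def using free_act_Vsp[OF xV] by blast
    show "0 \<in> U" unfolding U_def using zero A.zero_closed by (metis imageI)
    fix y assume "y \<in> U"
    then obtain p where p: "p \<in> acarr ?A" "y = free_act p x" by (auto simp: U_def)
    show "- y \<in> U"
      unfolding U_def using scale[of "- 1" p] p A.scale_closed[OF p(1), of "- 1"]
      by (intro image_eqI[of _ _ "ascale ?A (- 1) p"]) simp_all
    show "y + z \<in> U" if "z \<in> U" for z
      using that p unfolding U_def by (auto simp flip: add)
    show "act y a \<in> U" if a: "a \<in> acarr LA" for a
    proof -
      have "y \<in> Vsp F" using p free_act_Vsp[OF xV] by simp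
      then obtain q where "q \<in> acarr ?A" "act y a = free_act q y"
        by (rule bexE[OF act_cases[OF _ a]])
      with p show ?thesis unfolding U_def by (auto simp flip: mult)
    qed
  qed
  moreover have "U \<noteq> {0}"
  proof -
    from x have "x \<noteq> 0" by simp
    then obtain s where s: "s \<in> Poly_Mapping.keys x" by fastforce
    \<comment> \<open>the vertex below \<open>s\<close> preserves the coefficient at \<open>s\<close>, so the orbit contains a nonzero vector\<close>
    have each: "Poly_Mapping.lookup (pm_scale (Poly_Mapping.lookup x w) (vec_of (word_step [Vert (\<phi>0 s)] w))) s =
        (if w = s then Poly_Mapping.lookup x s else 0)" for w
      by (cases "\<phi>0 w = \<phi>0 s") (auto simp: basis_vec_def lookup_single when_def)
    have "Poly_Mapping.lookup (free_act (word [Vert (\<phi>0 s)]) x) s =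
        (\<Sum>w\<in>Poly_Mapping.keys x. if w = s then Poly_Mapping.lookup x s else 0)"
      by (simp only: free_act_word word_act_def lin_def lookup_sum each)
    also have "\<dots> = Poly_Mapping.lookup x s" using s by simp
    finally have "free_act (word [Vert (\<phi>0 s)]) x \<noteq> 0" using s by (auto simp: in_keys_iff)
    moreover have "\<phi>0 s \<in> verts E" using s xV hom_vert by (auto simp: Vsp_def)
    then have "word [Vert (\<phi>0 s)] \<in> acarr ?A" by (simp add: word_in_free_alg vert_in_gens)
    ultimately show ?thesis unfolding U_def by blast
  qed
  ultimately have U: "U = Vsp F" using simple unfolding simple_right_module_def by blast
  obtain w where w: "w \<in> verts F" using F.verts_nonempty by blast
  then have "basis_vec w \<in> U" unfolding U by simp
  then obtain p where p: "p \<in> acarr ?A" "basis_vec w = free_act p x" by (auto simp: U_def)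
  then have "act x (class_of p) = basis_vec w" using rep_act_class_of[OF p(1) xV] by simp
  moreover have "class_of p \<in> acarr LA" unfolding class_of_surj using p(1) by (rule imageI)
  ultimately show ?thesis using w by (metis imageI)
qed

text \<open>
  A submodule with a basis vector \<open>w\<close> contains \<open>k v\<close> for every vertex \<open>v\<close> and scalar \<open>k\<close>: act with
  \<open>k\<close> times the image of a walk from \<open>w\<close> to \<open>v\<close>. In particular it is closed under scalars, although submodules
  are only additive subgroups by definition.
\<close>

lemma simple_if_basis_vec:
  assumes basis: "\<forall>x\<in>Vsp F - {0 :: 'w \<Rightarrow>\<^sub>0 'k::field}. \<exists>a\<in>acarr LA. act x a \<in> basis_vec ` verts F"
  shows "simple_right_module LA (Vsp F :: ('w \<Rightarrow>\<^sub>0 'k) set) act"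
  unfolding simple_right_module_def
proof (intro conjI allI impI)
  obtain w where w: "w \<in> verts F" using F.verts_nonempty by blast
  then have "basis_vec w \<in> (Vsp F :: ('w \<Rightarrow>\<^sub>0 'k) set)" by simp
  then show "(Vsp F :: ('w \<Rightarrow>\<^sub>0 'k) set) \<noteq> {0}" by (metis basis_vec_neq_0 singletonD)
  fix U :: "('w \<Rightarrow>\<^sub>0 'k) set" assume sub: "right_submodule LA (Vsp F) act U"
  have UV: "U \<subseteq> Vsp F" and U0: "0 \<in> U" and Uadd: "\<And>x y. x \<in> U \<Longrightarrow> y \<in> U \<Longrightarrow> x + y \<in> U"
    and Uact: "\<And>x a. x \<in> U \<Longrightarrow> a \<in> acarr LA \<Longrightarrow> act x a \<in> U"
    using sub by (auto simp: right_submodule_def)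
  show "U = {0} \<or> U = Vsp F"
  proof (cases "U = {0}")
    case False
    with U0 obtain x where "x \<in> U" "x \<noteq> 0" by blast
    then obtain a w where a: "a \<in> acarr LA" "act x a = basis_vec w" "w \<in> verts F"
      using basis UV by blast
    then have wU: "basis_vec w \<in> U" using Uact[OF \<open>x \<in> U\<close> a(1)] by simp
    have single: "Poly_Mapping.single v k \<in> U" if v: "v \<in> verts F" for v k
    proof -
      obtain q where "pre_digraph.awalk (double_graph F) w q v"
        using F.walk_connected[OF a(3) v] by blast
      from word_step_image_walk[OF this]
      have step: "word_step (map Edge (map (map_dedge \<phi>1) q)) w = Some v" .
      let ?q = "map (map_dedge \<phi>1) q"
      have walk: "(\<phi>0 w, ?q) \<in> Walk E"
        using awalk_if_word_step[OF step a(3)] by (auto simp: Walk_def)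
      have "basis_vec w \<in> (Vsp F :: ('w \<Rightarrow>\<^sub>0 'k) set)" using a(3) by simp
      note act_walk(1)[OF walk this, of k]
      moreover have "word_step (Vert (\<phi>0 w) # map Edge ?q) w = Some v" using step by simp
      ultimately have "act (basis_vec w) (ascale LA k (lpa_walk E C D (\<phi>0 w, ?q))) = Poly_Mapping.single v k"
        by (simp add: basis_vec_def[of v] del: word_step.simps)
      then show ?thesis
        using Uact[OF wU act_walk(2)[OF walk], of k] by simp
    qed
    have "y \<in> U" if y: "y \<in> Vsp F" for y
    proof -
      have "(\<Sum>v\<in>T. Poly_Mapping.single v (Poly_Mapping.lookup y v)) \<in> U"
        if "finite T" "T \<subseteq> verts F" for T
        using that by (induction T) (auto intro: U0 Uadd single)
      from this[of "Poly_Mapping.keys y"] show ?thesis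
        using y lin_basis[of y] by (simp add: lin_def Vsp_def)
    qed
    with UV show ?thesis by blast
  qed simp
qed

end

theorem theorem4p11:
  fixes E :: "('v, 'e) pre_digraph" and C D :: "'v \<Rightarrow> 'e set set"
    and F :: "('w, 'f) pre_digraph" and \<phi>0 :: "'w \<Rightarrow> 'v" and \<phi>1 :: "'f \<Rightarrow> 'e"
    and L :: "('k::field, ('v, 'e, 'k) lpa) nalg"
    and V :: "('w \<Rightarrow>\<^sub>0 'k) set"
    and act :: "('w \<Rightarrow>\<^sub>0 'k) \<Rightarrow> ('v, 'e, 'k) lpa \<Rightarrow> ('w \<Rightarrow>\<^sub>0 'k)"
  assumes rep: "rep_graph E C D F \<phi>0 \<phi>1"
  defines "L \<equiv> leavitt_alg E C D"
    and "V \<equiv> Vsp F"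
    and "act \<equiv> rep_act E C D F \<phi>0 \<phi>1"
  shows "(simple_right_module L V act \<longleftrightarrow>
            (\<forall>x\<in>V - {0}. \<exists>a\<in>acarr L. act x a \<in> basis_vec ` verts F)) \<and>
         ((\<forall>x\<in>V - {0}. \<exists>a\<in>acarr L. act x a \<in> basis_vec ` verts F) \<longleftrightarrow>
            (\<forall>x\<in>V - {0}. \<exists>k. \<exists>p\<in>Walk E.
               act x (ascale L k (lpa_walk E C D p)) \<in> basis_vec ` verts F)) \<and>
         ((\<forall>x\<in>V - {0}. \<exists>k. \<exists>p\<in>Walk E.
               act x (ascale L k (lpa_walk E C D p)) \<in> basis_vec ` verts F) \<longleftrightarrow>
            irreducible_rep F \<phi>0 \<phi>1)"
    (is "(?i \<longleftrightarrow> ?ii) \<and> (?ii \<longleftrightarrow> ?iii) \<and> (?iii \<longleftrightarrow> ?iv)")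
proof -
  interpret rep_graph E C D F \<phi>0 \<phi>1 by (rule rep)
  have "?i \<longleftrightarrow> ?ii"
    unfolding L_def V_def act_def using basis_vec_if_simple simple_if_basis_vec by blast
  moreover have "?ii \<Longrightarrow> ?iv"
    unfolding L_def V_def act_def by (rule irreducible_if_basis_vec)
  moreover have "?iv \<Longrightarrow> ?iii"
    unfolding L_def V_def act_def using basis_vec_if_irreducible by blast
  moreover have "?iii \<Longrightarrow> ?ii"
  proof
    fix x assume iii: ?iii and x: "x \<in> V - {0}"
    then obtain k a q where "(a, q) \<in> Walk E"
      "act x (ascale L k (lpa_walk E C D (a, q))) \<in> basis_vec ` verts F"
      by (metis surj_pair)
    moreover from this(1) have "ascale L k (lpa_walk E C D (a, q)) \<in> acarr L"
      unfolding L_def by (rule act_walk(2))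
    ultimately show "\<exists>a\<in>acarr L. act x a \<in> basis_vec ` verts F" by blast
  qed
  ultimately show ?thesis by blast
qed

end
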